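(* Let $A\in\mathbb{R}^{n\times n}$, $B\in\mathbb{R}^{n\times m}$ with $(A,B)$ controllable, let $\mathcal{L}$ be the Laplacian of a weighted directed graph on $N$ nodes containing a spanning tree, with eigenvalues $\lambda_1=0,\lambda_2,\dots,\lambda_N$, and let $Q\in\mathbb{S}^n_+$, $\gamma>0$, $\mu\ge1$. Let $H=\begin{bmatrix}H_{11}&H_{12}\\H_{12}^T&H_{22}\end{bmatrix}\in\mathbb{S}^{n+m}$ be the optimal solution of the semidefinite program with variables $H\in\mathbb{S}^{n+m}$, $W\in\mathbb{R}^{n\times n}$: $$\text{maximize}_{H,W}\ \operatorname{trace}(W)\quad\text{subject to}\quad \begin{bmatrix}H_{11}-W&H_{12}\\H_{12}^T&H_{22}\end{bmatrix}\succeq 0,\quad \begin{bmatrix}\mu^2[A\ B]^TH_{11}[A\ B]-H+\begin{bmatrix}Q&0\\0&\gamma I_m\end{bmatrix}&\mu[A\ B]^TH_{12}\\ \mu H_{12}^T[A\ B]&H_{22}\end{bmatrix}\succeq 0.$$ Define $P=H_{11}-H_{12}H_{22}^{-1}H_{12}^T$ and $K=H_{22}^{-1}H_{12}^T$. Assume there exists a coupling gain $c>0$ such that $$P-(\mu A-\mu c\lambda_iBK)^*P(\mu A-\mu c\lambda_iBK)\succ0\quad\text{for all } i=2,\dots,N.$$ Then the iterative convex–concave algorithm described in the context generates a sequence of iterates $\{(\alpha^{(k)},\beta^{(k)},c^{(k)})\}$ such that (i) the scalar objective sequence $\{\alpha^{(k)}\}$ is non-decreasing; (ii) the algorithm, initialized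 arbitrarily, converges to a limit point that is a stationary point of the non-convex problem $$\text{maximize}_{\alpha,\beta,c}\ \alpha\quad\text{subject to}\quad \mathcal{S}_{q_i}(\beta,c,\lambda_i,H)\succeq\alpha I,\quad \mathcal{N}_i(\beta,c,\lambda_i)\succeq0,\quad i=2,\dots,N,$$ where $\mathcal{S}_{q_i}$ and $\mathcal{N}_i$ are the matrices defined in the context.
   Context: $\mathbb{S}^n$ and $\mathbb{S}^n_+$ denote the real symmetric and symmetric positive semidefinite $n\times n$ matrices; $X\succeq0$ ($X\succ0$) means $X$ is symmetric (Hermitian, in the complex case) positive semidefinite (definite); $^*$ is conjugate transpose. Graph: for a directed graph with weights $a_{ij}>0$ if there is an edge from node $j$ to node $i$ and $a_{ij}=0$ otherwise, the Laplacian is $\mathcal{L}=\operatorname{diag}(\sum_ja_{ij})-[a_{ij}]$. The graph contains a spanning tree if some node has a directed path to every other node; then $\lambda_1=0$ is a simple eigenvalue of $\mathcal{L}$ and $\lambda_2,\dots,\lambda_N$ (possibly complex, with multiplicity) have positive real parts. Matrices, for real $\beta,c,c^{(k)}$: $$\mathcal{S}_{q_i}(\beta,c,\lambda_i,H)=\begin{bmatrix}Q+c^2\gamma|\lambda_i|^2H_{12}H_{22}^{-2}H_{12}^T&\beta H_{12}\\ \beta H_{12}^T&H_{22}\end{bmatrix},$$ $$\mathcal{S}_{l_i}(\beta,c,c^{(k)},\lambda_i,H)=\begin{bmatrix}Q+\left(2c^{(k)}c-(c^{(k)})^2\right)\gamma|\lambda_i|^2H_{12}H_{22}^{-2}H_{12}^T&\beta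 H_{12}\\ \beta H_{12}^T&H_{22}\end{bmatrix},$$ $$\mathcal{N}_i(\beta,c,\lambda_i)=\begin{bmatrix}\beta-\sqrt{1-\frac{(\operatorname{Re}\lambda_i)^2}{|\lambda_i|^2}}&\frac{1}{|\lambda_i|}(c|\lambda_i|^2-\operatorname{Re}\lambda_i)\\ \frac{1}{|\lambda_i|}(c|\lambda_i|^2-\operatorname{Re}\lambda_i)&\beta+\sqrt{1-\frac{(\operatorname{Re}\lambda_i)^2}{|\lambda_i|^2}}\end{bmatrix}.$$ Algorithm: initialize $c^{(0)}\in\mathbb{R}$ arbitrarily. For $k=0,1,2,\dots$, let $(\alpha^{(k+1)},\beta^{(k+1)},c^{(k+1)})$ be an optimal solution of the semidefinite program $$\text{maximize}_{\alpha,\beta,c}\ \alpha\quad\text{subject to}\quad \mathcal{S}_{l_i}(\beta,c,c^{(k)},\lambda_i,H)\succeq\alpha I,\quad \mathcal{N}_i(\beta,c,\lambda_i)\succeq0,\quad i=2,\dots,N.$$ (In practice the algorithm is stopped when $|\alpha^{(k+1)}-\alpha^{(k)}|\le\epsilon$ for a tolerance $\epsilon$, reporting feasibility if $\alpha^{(k+1)}\ge0$; the convergence statement concerns the sequence of iterates produced without this stopping test.) "Stationary point" is meant in the usual sense of first-order (KKT) conditions for the semidefinite-constrained problem, as in convex–concave programming.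
   Formalization: Convergence in (ii) can fail (A=0, B=Q=I: c^(k)=k is admissible). Proved: α^(k) converges; every limit point of the iterates is stationary; if the iterates are bounded, a limit point exists and their distance to the set of stationary points tends to 0. H22 is assumed invertible. *)

theory Defs
  imports "HOL-Analysis.Analysis"
begin

text \<open>Matrices with \<open>r\<close> rows and \<open>s\<close> columns have type \<^typ>\<open>real ^ 's ^ 'r\<close>; block matrices are
  indexed by sum types, and \<open>\<alpha> I\<close> is \<^term>\<open>mat \<alpha>\<close>.\<close>

section \<open>Matrices\<close>

definition pos_semidef :: "real ^ 'k ^ 'k \<Rightarrow> bool" where
  "pos_semidef M \<longleftrightarrow> transpose M = M \<and> (\<forall>x. 0 \<le> x \<bullet> (M *v x))"

abbreviation cmat :: "real ^ 's ^ 'r \<Rightarrow> complex ^ 's ^ 'r" where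
  "cmat \<equiv> map_matrix complex_of_real"

definition conj_transpose :: "complex ^ 's ^ 'r \<Rightarrow> complex ^ 'r ^ 's" where
  "conj_transpose M = transpose (map_matrix cnj M)"

text \<open>For Hermitian \<open>M\<close> the form \<open>x\<^sup>* M x\<close> is real, so \<^const>\<open>Re\<close> discards nothing.\<close>

definition pos_def_complex :: "complex ^ 'k ^ 'k \<Rightarrow> bool" where
  "pos_def_complex M \<longleftrightarrow> conj_transpose M = M \<and>
     (\<forall>x. x \<noteq> 0 \<longrightarrow> 0 < Re (\<Sum>i\<in>UNIV. cnj (x $ i) * (M *v x) $ i))"

definition block_mat ::
  "'a ^ 'c ^ 'r \<Rightarrow> 'a ^ 'd ^ 'r \<Rightarrow> 'a ^ 'c ^ 's \<Rightarrow> 'a ^ 'd ^ 's \<Rightarrow> 'a ^ ('c::finite + 'd::finite) ^ ('r::finite + 's::finite)" where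
  "block_mat M11 M12 M21 M22 = (\<chi> i j.
     (case i of
        Inl r \<Rightarrow> (case j of Inl c \<Rightarrow> M11 $ r $ c | Inr d \<Rightarrow> M12 $ r $ d)
      | Inr s \<Rightarrow> (case j of Inl c \<Rightarrow> M21 $ s $ c | Inr d \<Rightarrow> M22 $ s $ d)))"

definition block_row :: "'a ^ 'c ^ 'r \<Rightarrow> 'a ^ 'd ^ 'r \<Rightarrow> 'a ^ ('c::finite + 'd::finite) ^ 'r" where
  "block_row M1 M2 = (\<chi> i j. (case j of Inl c \<Rightarrow> M1 $ i $ c | Inr d \<Rightarrow> M2 $ i $ d))"

definition blk11 :: "real ^ ('n::finite + 'm::finite) ^ ('n::finite + 'm::finite) \<Rightarrow> real ^ 'n ^ 'n" where
  "blk11 H = (\<chi> i j. H $ Inl i $ Inl j)"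

definition blk12 :: "real ^ ('n::finite + 'm::finite) ^ ('n::finite + 'm::finite) \<Rightarrow> real ^ 'm ^ 'n" where
  "blk12 H = (\<chi> i j. H $ Inl i $ Inr j)"

definition blk22 :: "real ^ ('n::finite + 'm::finite) ^ ('n::finite + 'm::finite) \<Rightarrow> real ^ 'm ^ 'm" where
  "blk22 H = (\<chi> i j. H $ Inr i $ Inr j)"

text \<open>Kalman's rank condition: the columns of \<open>[B, A B, \<dots>, A^(n-1) B]\<close> span the state space.\<close>

definition controllable :: "real ^ 'n ^ 'n \<Rightarrow> real ^ 'm ^ 'n \<Rightarrow> bool" where
  "controllable A B \<longleftrightarrow> span (\<Union>k<CARD('n). columns (((**) A ^^ k) B)) = UNIV"

section \<open>Weighted directed graphs\<close>

text \<open>\<open>a $ i $ j\<close> is the weight of the edge from \<open>j\<close> to \<open>i\<close>, and \<open>0\<close> if there is no such edge.\<close>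

definition edges :: "real ^ 'v ^ 'v \<Rightarrow> ('v \<times> 'v) set" where
  "edges a = {(j, i). a $ i $ j > 0}"

definition has_spanning_tree :: "real ^ 'v ^ 'v \<Rightarrow> bool" where
  "has_spanning_tree a \<longleftrightarrow> (\<exists>r. \<forall>v. (r, v) \<in> (edges a)\<^sup>*)"

definition laplacian :: "real ^ 'v ^ 'v \<Rightarrow> real ^ 'v ^ 'v" where
  "laplacian a = (\<chi> i j. if i = j then \<Sum>k\<in>UNIV. a $ i $ k else 0) - a"

text \<open>\<open>\<Lambda> 1, \<dots>, \<Lambda> N\<close> lists the eigenvalues with algebraic multiplicity, that is, the roots of the
  characteristic polynomial.\<close>

definition eigenvalue_list :: "complex ^ 'v ^ 'v \<Rightarrow> (nat \<Rightarrow> complex) \<Rightarrow> bool" where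
  "eigenvalue_list M \<Lambda> \<longleftrightarrow> (\<forall>z. det (mat z - M) = (\<Prod>i=1..CARD('v). z - \<Lambda> i))"

section \<open>The semidefinite program that determines \<open>H\<close>\<close>

definition H_feasible ::
  "real ^ 'n ^ 'n \<Rightarrow> real ^ 'm ^ 'n \<Rightarrow> real ^ 'n ^ 'n \<Rightarrow> real \<Rightarrow> real \<Rightarrow>
    (real ^ ('n::finite + 'm::finite) ^ ('n::finite + 'm::finite)) \<times> (real ^ 'n ^ 'n) \<Rightarrow> bool" where
  "H_feasible A B Q \<gamma> \<mu> = (\<lambda>(H, W).
     transpose H = H \<and>
     pos_semidef (block_mat (blk11 H - W) (blk12 H) (transpose (blk12 H)) (blk22 H)) \<and>
     pos_semidef (block_mat
       (\<mu>\<^sup>2 *\<^sub>R (transpose (block_row A B) ** blk11 H ** block_row A B) - H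
          + block_mat Q 0 0 (mat \<gamma>))
       (\<mu> *\<^sub>R (transpose (block_row A B) ** blk12 H))
       (\<mu> *\<^sub>R (transpose (blk12 H) ** block_row A B))
       (blk22 H)))"

definition H_optimal ::
  "real ^ 'n ^ 'n \<Rightarrow> real ^ 'm ^ 'n \<Rightarrow> real ^ 'n ^ 'n \<Rightarrow> real \<Rightarrow> real \<Rightarrow>
    real ^ ('n::finite + 'm::finite) ^ ('n::finite + 'm::finite) \<Rightarrow> bool" where
  "H_optimal A B Q \<gamma> \<mu> H \<longleftrightarrow>
     (\<exists>W. is_arg_max (\<lambda>(H, W). trace W) (H_feasible A B Q \<gamma> \<mu>) (H, W))"

definition P_of :: "real ^ ('n::finite + 'm::finite) ^ ('n::finite + 'm::finite) \<Rightarrow> real ^ 'n ^ 'n" where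
  "P_of H = blk11 H - blk12 H ** matrix_inv (blk22 H) ** transpose (blk12 H)"

definition K_of :: "real ^ ('n::finite + 'm::finite) ^ ('n::finite + 'm::finite) \<Rightarrow> real ^ 'n ^ 'm" where
  "K_of H = matrix_inv (blk22 H) ** transpose (blk12 H)"

definition closed_loop ::
  "real ^ 'n ^ 'n \<Rightarrow> real ^ 'm ^ 'n \<Rightarrow> real ^ 'n ^ 'm \<Rightarrow> real \<Rightarrow> real \<Rightarrow> complex \<Rightarrow> complex ^ 'n ^ 'n" where
  "closed_loop A B K \<mu> c l =
     cmat (\<mu> *\<^sub>R A) - map_matrix ((*) (complex_of_real (\<mu> * c) * l)) (cmat (B ** K))"

section \<open>The non-convex problem and its convexified subproblem\<close>

definition S_mat ::
  "real ^ 'n ^ 'n \<Rightarrow> real \<Rightarrow> real ^ ('n::finite + 'm::finite) ^ ('n::finite + 'm::finite) \<Rightarrow> complex \<Rightarrow> real \<Rightarrow> real \<Rightarrow>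
    real ^ ('n::finite + 'm::finite) ^ ('n::finite + 'm::finite)" where
  "S_mat Q \<gamma> H l t \<beta> = block_mat
     (Q + (t * \<gamma> * (cmod l)\<^sup>2) *\<^sub>R
        (blk12 H ** (matrix_inv (blk22 H) ** matrix_inv (blk22 H)) ** transpose (blk12 H)))
     (\<beta> *\<^sub>R blk12 H)
     (\<beta> *\<^sub>R transpose (blk12 H))
     (blk22 H)"

definition S_q ::
  "real ^ 'n ^ 'n \<Rightarrow> real \<Rightarrow> real \<Rightarrow> real \<Rightarrow> complex \<Rightarrow> real ^ ('n::finite + 'm::finite) ^ ('n::finite + 'm::finite) \<Rightarrow>
    real ^ ('n::finite + 'm::finite) ^ ('n::finite + 'm::finite)" where
  "S_q Q \<gamma> \<beta> c l H = S_mat Q \<gamma> H l (c\<^sup>2) \<beta>"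

definition S_l ::
  "real ^ 'n ^ 'n \<Rightarrow> real \<Rightarrow> real \<Rightarrow> real \<Rightarrow> real \<Rightarrow> complex \<Rightarrow> real ^ ('n::finite + 'm::finite) ^ ('n::finite + 'm::finite) \<Rightarrow>
    real ^ ('n::finite + 'm::finite) ^ ('n::finite + 'm::finite)" where
  "S_l Q \<gamma> \<beta> c ck l H = S_mat Q \<gamma> H l (2 * ck * c - ck\<^sup>2) \<beta>"

definition N_mat :: "real \<Rightarrow> real \<Rightarrow> complex \<Rightarrow> real ^ 2 ^ 2" where
  "N_mat \<beta> c l =
     (let s = sqrt (1 - (Re l)\<^sup>2 / (cmod l)\<^sup>2);
          d = 1 / cmod l * (c * (cmod l)\<^sup>2 - Re l)
      in vector [vector [\<beta> - s, d], vector [d, \<beta> + s]])"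

text \<open>Points are triples \<open>(\<alpha>, \<beta>, c)\<close>; the objective \<open>\<alpha>\<close> is \<^const>\<open>fst\<close>.\<close>

definition subproblem_feasible ::
  "real ^ 'n ^ 'n \<Rightarrow> real \<Rightarrow> real ^ ('n::finite + 'm::finite) ^ ('n::finite + 'm::finite) \<Rightarrow> (nat \<Rightarrow> complex) \<Rightarrow> nat \<Rightarrow> real \<Rightarrow>
    real \<times> real \<times> real \<Rightarrow> bool" where
  "subproblem_feasible Q \<gamma> H \<Lambda> N ck = (\<lambda>(\<alpha>, \<beta>, c). \<forall>i\<in>{2..N}.
     pos_semidef (S_l Q \<gamma> \<beta> c ck (\<Lambda> i) H - mat \<alpha>) \<and> pos_semidef (N_mat \<beta> c (\<Lambda> i)))"

text \<open>Only \<open>c 0\<close> is an input of the algorithm; \<open>\<alpha> 0\<close> and \<open>\<beta> 0\<close> carry no meaning.\<close>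

definition ccp_iterates ::
  "real ^ 'n ^ 'n \<Rightarrow> real \<Rightarrow> real ^ ('n::finite + 'm::finite) ^ ('n::finite + 'm::finite) \<Rightarrow> (nat \<Rightarrow> complex) \<Rightarrow> nat \<Rightarrow>
    (nat \<Rightarrow> real) \<Rightarrow> (nat \<Rightarrow> real) \<Rightarrow> (nat \<Rightarrow> real) \<Rightarrow> bool" where
  "ccp_iterates Q \<gamma> H \<Lambda> N \<alpha> \<beta> c \<longleftrightarrow>
     (\<forall>k. is_arg_max fst (subproblem_feasible Q \<gamma> H \<Lambda> N (c k))
        (\<alpha> (Suc k), \<beta> (Suc k), c (Suc k)))"

text \<open>KKT conditions for maximizing \<open>f x\<close> subject to \<open>F i x \<succeq> 0\<close> and \<open>G i x \<succeq> 0\<close> for \<open>i \<in> I\<close>: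
  primal feasibility, positive semidefinite multipliers \<open>Y i\<close> and \<open>Z i\<close>, complementary slackness,
  and vanishing derivative of the Lagrangian.\<close>

definition kkt_point ::
  "('x::real_normed_vector \<Rightarrow> real) \<Rightarrow> 'i set \<Rightarrow> ('i \<Rightarrow> 'x \<Rightarrow> real ^ 'k ^ 'k) \<Rightarrow>
    ('i \<Rightarrow> 'x \<Rightarrow> real ^ 'l ^ 'l) \<Rightarrow> 'x \<Rightarrow> bool" where
  "kkt_point f I F G x \<longleftrightarrow>
     (\<forall>i\<in>I. pos_semidef (F i x) \<and> pos_semidef (G i x)) \<and>
     (\<exists>Y Z.
        (\<forall>i\<in>I. pos_semidef (Y i) \<and> pos_semidef (Z i)) \<and>
        (\<forall>i\<in>I. trace (Y i ** F i x) = 0 \<and> trace (Z i ** G i x) = 0) \<and>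
        ((\<lambda>y. f y + (\<Sum>i\<in>I. trace (Y i ** F i y)) + (\<Sum>i\<in>I. trace (Z i ** G i y)))
           has_derivative (\<lambda>_. 0)) (at x))"

definition stationary ::
  "real ^ 'n ^ 'n \<Rightarrow> real \<Rightarrow> real ^ ('n::finite + 'm::finite) ^ ('n::finite + 'm::finite) \<Rightarrow> (nat \<Rightarrow> complex) \<Rightarrow> nat \<Rightarrow>
    real \<times> real \<times> real \<Rightarrow> bool" where
  "stationary Q \<gamma> H \<Lambda> N = kkt_point fst {2..N}
     (\<lambda>i (\<alpha>, \<beta>, c). S_q Q \<gamma> \<beta> c (\<Lambda> i) H - mat \<alpha>)
     (\<lambda>i (\<alpha>, \<beta>, c). N_mat \<beta> c (\<Lambda> i))"

definition seq_limit_point :: "(nat \<Rightarrow> 'x::topological_space) \<Rightarrow> 'x \<Rightarrow> bool" where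
  "seq_limit_point X x \<longleftrightarrow> (\<exists>r. strict_mono r \<and> (X \<circ> r) \<longlonglongrightarrow> x)"

end

theory Submission
  imports Defs
begin

text \<open>Replacing \<open>c\<^sup>2\<close> by its tangent at \<open>c\<^sup>(\<^sup>k\<^sup>)\<close> shrinks the feasible set, since the coefficient of \<open>c\<^sup>2\<close> is
  positive semidefinite. Hence each iterate is feasible for the next subproblem, and the objective
  increases; it is bounded by a diagonal entry of \<open>H\<^sub>2\<^sub>2\<close>. Let \<open>x\<close> be a limit point with gain \<open>c\<close>. If the
  subproblem linearized at \<open>c\<close> had a better point than \<open>x\<close>, then a slight decrease of its \<open>\<alpha>\<close> would make it
  feasible for some subproblem along the subsequence, and the next iterate would exceed the limit of the objective.
  So \<open>x\<close> solves a convex semidefinite program with a Slater point and has multipliers there. They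
  serve the non-convex problem too, because \<open>c\<^sup>2\<close> and its tangent agree to first order.

  Subproblems attain their maximum since \<open>N\<^sub>i \<succeq> 0\<close> makes \<open>\<beta>\<close> grow linearly in \<open>\<bar>c\<bar>\<close>, so that \<open>\<beta>\<^sup>2\<close>
  outgrows the linearized term in the Schur complement of \<open>S\<^sub>l\<close>.\<close>

section \<open>Quadratic forms\<close>

definition qform :: "real ^ 'k ^ 'k \<Rightarrow> real ^ 'k \<Rightarrow> real" where
  "qform M x = x \<bullet> (M *v x)"

lemma qform_expand: "qform M x = (\<Sum>i\<in>UNIV. \<Sum>j\<in>UNIV. M $ i $ j * (x $ i * x $ j))"
  by (simp add: qform_def inner_vec_def matrix_vector_mult_def sum_distrib_left mult_ac)

lemma qform_add [simp]: "qform (M + M') x = qform M x + qform M' x"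
  by (simp add: qform_def algebra_simps inner_add_right)

lemma qform_diff [simp]: "qform (M - M') x = qform M x - qform M' x"
  by (simp add: qform_def algebra_simps inner_diff_right)

lemma qform_scaleR [simp]: "qform (r *\<^sub>R M) x = r * qform M x"
  by (simp add: qform_def flip: scaleR_matrix_vector_assoc)

lemma qform_mat [simp]: "qform (mat r) x = r * (norm x)\<^sup>2"
proof -
  have "mat r *v x = r *\<^sub>R x"
    by (simp add: vec_eq_iff matrix_vector_mult_def mat_def if_distrib if_distribR cong: if_cong)
  then show ?thesis by (simp add: qform_def power2_norm_eq_inner)
qed

lemma qform_zero [simp]: "qform M 0 = 0"
  by (simp add: qform_def)

lemma qform_scaleR_right: "qform M (r *\<^sub>R x) = r\<^sup>2 * qform M x"
  by (simp add: qform_def matrix_vector_mult_scaleR power2_eq_square)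

lemma continuous_on_qform [continuous_intros]:
  fixes M :: "real ^ 'k ^ 'k"
  assumes "continuous_on S f" shows "continuous_on S (\<lambda>x. qform M (f x))"
  unfolding qform_expand using assms by (intro continuous_intros)

lemma continuous_on_qform_left [continuous_intros]:
  fixes f :: "'a::topological_space \<Rightarrow> real ^ 'k ^ 'k"
  assumes "continuous_on S f" shows "continuous_on S (\<lambda>x. qform (f x) u)"
  unfolding qform_expand using assms by (intro continuous_intros)

text \<open>Testing semidefiniteness on vectors with at most two nonzero coordinates is how
  entrywise inequalities are extracted; \<open>s = 0\<close> isolates a diagonal entry.\<close>

lemma qform_two_axes:
  fixes M :: "real ^ 'k ^ 'k"
  shows "qform M (axis p 1 + s *\<^sub>R axis q 1) = M $ p $ p + s * (M $ p $ q + M $ q $ p) + s\<^sup>2 * M $ q $ q"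
proof -
  have "axis i 1 \<bullet> (M *v axis j 1) = M $ i $ j" for i j
    by (simp add: matrix_vector_mul_component[symmetric] matrix_vector_mult_basis column_def inner_axis')
  then show ?thesis
    by (simp add: qform_def algebra_simps inner_add_left inner_add_right power2_eq_square)
qed

text \<open>Adding 1 to the operator norm keeps the bound positive even for \<open>M = 0\<close>, so
  that it can serve as a divisor.\<close>

lemma qform_bound:
  fixes M :: "real ^ 'k ^ 'k"
  obtains b where "b > 0" "\<And>x. \<bar>qform M x\<bar> \<le> b * (norm x)\<^sup>2"
proof
  fix x
  have "\<bar>qform M x\<bar> \<le> norm x * norm (M *v x)"
    by (simp add: qform_def Cauchy_Schwarz_ineq2)
  also have "\<dots> \<le> norm x * (onorm ((*v) M) * norm x)"
    by (intro mult_left_mono onorm) auto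
  also have "\<dots> \<le> (onorm ((*v) M) + 1) * (norm x)\<^sup>2"
    by (simp add: power2_eq_square algebra_simps)
  finally show "\<bar>qform M x\<bar> \<le> (onorm ((*v) M) + 1) * (norm x)\<^sup>2" .
  show "onorm ((*v) M) + 1 > 0"
    using onorm_pos_le[of "(*v) M"] by simp
qed

section \<open>The cone of positive semidefinite matrices\<close>

lemma pos_semidef_iff_qform: "pos_semidef M \<longleftrightarrow> transpose M = M \<and> (\<forall>x. 0 \<le> qform M x)"
  by (simp add: pos_semidef_def qform_def)

lemma qform_nonneg: "pos_semidef M \<Longrightarrow> 0 \<le> qform M x"
  by (simp add: pos_semidef_iff_qform)

text \<open>The form is homogeneous of degree two. Restricting to the sphere makes the family of
  scalar constraints compact, as the multiplier argument requires.\<close>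

lemma qform_nonneg_sphere:
  assumes "\<And>u. u \<in> sphere 0 1 \<Longrightarrow> 0 \<le> qform M u" shows "0 \<le> qform M x"
proof (cases "x = 0")
  case False
  then have "0 \<le> qform M (x /\<^sub>R norm x)" by (intro assms) simp
  then show ?thesis using False by (simp add: qform_scaleR_right zero_le_mult_iff)
qed simp

lemma pos_semidef_iff_qform_sphere:
  "pos_semidef M \<longleftrightarrow> transpose M = M \<and> (\<forall>u\<in>sphere 0 1. 0 \<le> qform M u)"
  unfolding pos_semidef_iff_qform using qform_nonneg_sphere by blast

lemma transpose_add: "transpose (M + M') = transpose M + transpose M'"
  by (simp add: transpose_def vec_eq_iff)

lemma transpose_diff: "transpose (M - M') = transpose M - transpose M'"
  by (simp add: transpose_def vec_eq_iff)

lemma pos_semidef_add: "pos_semidef M \<Longrightarrow> pos_semidef M' \<Longrightarrow> pos_semidef (M + M')"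
  by (simp add: pos_semidef_iff_qform transpose_add)

lemma pos_semidef_scaleR: "0 \<le> r \<Longrightarrow> pos_semidef M \<Longrightarrow> pos_semidef (r *\<^sub>R M)"
  by (simp add: pos_semidef_iff_qform transpose_scalar)

lemma pos_semidef_0: "pos_semidef 0"
  by (simp add: pos_semidef_def transpose_def vec_eq_iff)

lemma pos_semidef_gram:
  fixes L :: "real ^ 'm ^ 'k"
  shows "pos_semidef (L ** transpose L)"
proof -
  have "x \<bullet> (L ** transpose L *v x) = (norm (x v* L))\<^sup>2" for x
    by (simp add: matrix_vector_mul_assoc[symmetric] dot_lmul_matrix[symmetric] power2_norm_eq_inner)
  then show ?thesis by (simp add: pos_semidef_def matrix_transpose_mul)
qed

lemma closed_pos_semidef: "closed {M :: real ^ 'k ^ 'k. pos_semidef M}"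
proof -
  have "closed {M :: real ^ 'k ^ 'k. (\<forall>i j. M $ j $ i = M $ i $ j) \<and> (\<forall>x. 0 \<le> qform M x)}"
    by (intro closed_Collect_conj closed_Collect_all closed_Collect_eq closed_Collect_le continuous_intros)
  then show ?thesis by (simp add: pos_semidef_iff_qform transpose_def vec_eq_iff)
qed

lemma closed_pos_semidef_preimage:
  fixes f :: "'a::topological_space \<Rightarrow> real ^ 'k ^ 'k"
  assumes "continuous_on UNIV f" shows "closed {x. pos_semidef (f x)}"
  using closed_vimage[OF closed_pos_semidef assms] by (simp add: vimage_def)

text \<open>Source of strictly feasible points: a large multiple of the identity dominates each of
  finitely many forms simultaneously.\<close>

lemma eventually_diagonal_dominates:
  fixes T :: "'i \<Rightarrow> real ^ 'k ^ 'k"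
  assumes "finite I"
  shows "\<forall>\<^sub>F b in at_top. \<forall>i\<in>I. \<forall>x. x \<noteq> 0 \<longrightarrow> 0 < qform (T i + mat b) x"
  unfolding eventually_ball_finite_distrib[OF assms]
proof
  fix i
  obtain b0 where "b0 > 0" and b0: "\<And>x. \<bar>qform (T i) x\<bar> \<le> b0 * (norm x)\<^sup>2"
    using qform_bound by blast
  have "0 < qform (T i + mat b) x" if "b > b0" "x \<noteq> 0" for b x
  proof -
    have "b0 * (norm x)\<^sup>2 < b * (norm x)\<^sup>2" using that by simp
    then show ?thesis using b0[of x] by simp
  qed
  then show "\<forall>\<^sub>F b in at_top. \<forall>x. x \<noteq> 0 \<longrightarrow> 0 < qform (T i + mat b) x"
    using eventually_gt_at_top[of b0] by (elim eventually_mono) blast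
qed

lemma matrix_add_rdistrib:
  fixes M :: "'a::semiring_1 ^ 'n ^ 'm"
  shows "(M + M') ** N = M ** N + M' ** N"
  by (simp add: matrix_matrix_mult_def vec_eq_iff sum.distrib algebra_simps)

lemma trace_scaleR: "trace (r *\<^sub>R M) = r * trace (M :: real ^ 'k ^ 'k)"
  by (simp add: trace_def sum_distrib_left)

lemma trace_zero: "trace (0 :: real ^ 'k ^ 'k) = 0"
  by (simp add: trace_def)

text \<open>As a multiplier, the rank-one matrix \<open>u u^T\<close> reproduces the scalar
  constraint in direction \<open>u\<close>.\<close>

lemma trace_gram_mult:
  fixes M :: "real ^ 'k ^ 'k"
  shows "trace ((\<chi> i j. u $ i * u $ j) ** M) = qform M u"
  unfolding trace_def matrix_matrix_mult_def qform_expand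
  by (subst sum.swap) (simp add: mult_ac)

section \<open>Lagrange multipliers\<close>

text \<open>Moving along \<open>d\<close> can only hurt pairs with
  \<open>q \<bullet> d \<le> 0\<close>. On this compact part \<open>p\<close> has a positive lower
  bound, because \<open>p = 0\<close> would force \<open>q \<bullet> d > 0\<close>; since the
  \<open>q\<close> are bounded, a short step uses up at most that bound.\<close>

lemma compact_family_small_step:
  fixes C :: "(real \<times> 'x::euclidean_space) set"
  assumes "compact C" and nn: "\<And>p q. (p, q) \<in> C \<Longrightarrow> 0 \<le> p"
    and pos: "\<And>q. (0, q) \<in> C \<Longrightarrow> 0 < q \<bullet> d"
  shows "\<exists>t>0. \<forall>(p, q)\<in>C. 0 \<le> p + q \<bullet> (t *\<^sub>R d)"
proof -
  let ?C = "C \<inter> {z. snd z \<bullet> d \<le> 0}"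
  have "closed {z :: real \<times> 'x. snd z \<bullet> d \<le> 0}"
    by (intro closed_Collect_le continuous_intros)
  then have cC: "compact ?C" using assms(1) by (simp add: compact_Int_closed)
  obtain m where "m > 0" and m: "\<And>p q. (p, q) \<in> ?C \<Longrightarrow> m \<le> p"
  proof (cases "?C = {}")
    case False
    from continuous_attains_inf[OF cC False, of fst]
    obtain z where z: "z \<in> ?C" "\<And>y. y \<in> ?C \<Longrightarrow> fst z \<le> fst y"
      using continuous_on_fst[OF continuous_on_id] by blast
    moreover obtain p q where "z = (p, q)" by force
    ultimately have "p > 0" using nn[of p q] pos[of q] by (cases "p = 0") auto
    then show thesis using z \<open>z = (p, q)\<close> by (intro that[of p]) force+
  qed (use that[of 1] in auto)
  obtain b where "b > 0" and b: "\<And>z. z \<in> C \<Longrightarrow> norm z \<le> b"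
    using compact_imp_bounded[OF assms(1)] bounded_pos by blast
  \<comment> \<open>\<open>b * (norm d + 1)\<close> bounds \<open>\<bar>q \<bullet> d\<bar>\<close>,
    so the step loses at most \<open>m\<close>; the 1 keeps the divisor positive when
    \<open>d = 0\<close>.\<close>
  define t where "t = m / (b * (norm d + 1))"
  have "0 \<le> p + q \<bullet> (t *\<^sub>R d)" if pq: "(p, q) \<in> C" for p q
  proof (cases "q \<bullet> d \<le> 0")
    case True
    have "norm q \<le> b" using b[OF pq] norm_snd_le[of q p] by simp
    then have "norm q * norm d \<le> b * (norm d + 1)" using \<open>b > 0\<close> by (intro mult_mono) auto
    then have "\<bar>q \<bullet> d\<bar> \<le> b * (norm d + 1)"
      using Cauchy_Schwarz_ineq2[of q d] by linarith
    moreover have "b * (norm d + 1) > 0" using \<open>b > 0\<close> by (simp add: add_nonneg_pos)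
    ultimately have "t * \<bar>q \<bullet> d\<bar> \<le> m"
      using \<open>m > 0\<close> by (simp add: t_def divide_le_eq mult_left_mono)
    then show ?thesis using m[of p q] pq True by simp
  next
    case False
    then show ?thesis using nn[OF pq] \<open>m > 0\<close> \<open>b > 0\<close> by (simp add: t_def)
  qed
  moreover have "t > 0" using \<open>m > 0\<close> \<open>b > 0\<close> by (simp add: t_def add_nonneg_pos)
  ultimately show ?thesis by blast
qed

text \<open>First-order optimality of \<open>d = 0\<close> for maximizing
  \<open>e \<bullet> d\<close> under the compact family \<open>p + q \<bullet> d \<ge> 0\<close>.
  Separation yields a Fritz John relation between \<open>e\<close> and the active \<open>q\<close>,
  and the Slater direction \<open>w\<close> makes the weight of \<open>e\<close> nonzero.\<close>

lemma semi_infinite_multiplier: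
  fixes C :: "(real \<times> 'x::euclidean_space) set"
  assumes "compact C" and nn: "\<And>p q. (p, q) \<in> C \<Longrightarrow> 0 \<le> p"
    and opt: "\<And>d. (\<And>p q. (p, q) \<in> C \<Longrightarrow> 0 \<le> p + q \<bullet> d) \<Longrightarrow> e \<bullet> d \<le> 0"
    and slater: "\<And>p q. (p, q) \<in> C \<Longrightarrow> 0 < p + q \<bullet> w"
  shows "- e \<in> convex_cone hull {q. (0, q) \<in> C}"
proof -
  let ?K = "{q. (0, q) \<in> C}"
  have K: "?K = snd ` (C \<inter> {0} \<times> UNIV)" by force
  have "compact ?K"
    unfolding K using assms(1)
    by (intro compact_continuous_image compact_Int_closed continuous_intros closed_Times) auto
  then have cpt: "compact (convex hull insert e ?K)"
    by (intro compact_convex_hull compact_insert)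
  \<comment> \<open>Otherwise a separating direction would increase the objective and all active
    constraints at once, and a short step along it would contradict optimality.\<close>
  have "0 \<in> convex hull insert e ?K"
  proof (rule ccontr)
    assume "0 \<notin> convex hull insert e ?K"
    then obtain d b where "0 < b" and d: "\<And>x. x \<in> convex hull insert e ?K \<Longrightarrow> d \<bullet> x > b"
      using separating_hyperplane_closed_0[OF convex_convex_hull compact_imp_closed[OF cpt]] by metis
    have d_pos: "0 < d \<bullet> x" if "x \<in> insert e ?K" for x
      using d[of x] hull_inc[OF that] \<open>0 < b\<close> by force
    obtain t where "t > 0" and t: "\<forall>(p, q)\<in>C. 0 \<le> p + q \<bullet> (t *\<^sub>R d)"
      using compact_family_small_step[OF assms(1), of d] nn d_pos by (auto simp: inner_commute)
    have "e \<bullet> (t *\<^sub>R d) \<le> 0" using t by (intro opt) blast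
    then show False using d_pos[of e] \<open>t > 0\<close> by (simp add: inner_commute mult_le_0_iff)
  qed
  show ?thesis
  proof (cases "?K = {}")
    case True
    then have "e = 0" using \<open>0 \<in> convex hull insert e ?K\<close> by simp
    then show ?thesis by (simp add: convex_cone_hull_contains_0)
  next
    case False
    then obtain u v b where uv: "u \<ge> 0" "v \<ge> 0" "u + v = 1" and b: "b \<in> convex hull ?K"
        and eq: "0 = u *\<^sub>R e + v *\<^sub>R b"
      using \<open>0 \<in> convex hull insert e ?K\<close> unfolding convex_hull_insert[OF False] by blast
    \<comment> \<open>Active constraints have \<open>p = 0\<close>, so the Slater condition puts
      every active \<open>q\<close>, hence \<open>b\<close>, strictly on one side. A zero weight
      \<open>u\<close> would give \<open>b = 0\<close>.\<close>
    have "convex hull ?K \<subseteq> {q. w \<bullet> q > 0}"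
      using slater[of 0] by (intro hull_minimal convex_halfspace_gt) (auto simp: inner_commute)
    then have "u \<noteq> 0" using b eq uv by auto
    have "u *\<^sub>R (- e) = v *\<^sub>R b" using eq[symmetric] by (simp add: neg_eq_iff_add_eq_0)
    then have "- e = (v / u) *\<^sub>R b"
      using \<open>u \<noteq> 0\<close> by (metis divideR_right scaleR_scaleR divide_inverse_commute)
    moreover have "b \<in> convex_cone hull ?K"
      using b convex_hull_subset_convex_cone_hull by blast
    ultimately show ?thesis using uv convex_cone_hull_mul by (metis divide_nonneg_nonneg)
  qed
qed

text \<open>The Riesz vector of a linear functional; it puts derivatives of constraints into the
  form \<open>q \<bullet> d\<close> of the abstract multiplier lemma.\<close>

definition gradient :: "('x::euclidean_space \<Rightarrow> real) \<Rightarrow> 'x" where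
  "gradient f = (\<Sum>b\<in>Basis. f b *\<^sub>R b)"

lemma inner_gradient: "linear f \<Longrightarrow> gradient f \<bullet> d = f d"
  unfolding gradient_def
proof -
  assume "linear f"
  then have "f d = f (\<Sum>b\<in>Basis. (d \<bullet> b) *\<^sub>R b)" by (simp only: euclidean_representation)
  then show "(\<Sum>b\<in>Basis. f b *\<^sub>R b) \<bullet> d = f d"
    using \<open>linear f\<close> by (simp add: linear_sum linear_cmul inner_sum_left inner_commute[of d] mult.commute)
qed

lemma linear_qform: "linear L \<Longrightarrow> linear (\<lambda>d. qform (L d) u)"
  by (rule linearI) (simp_all add: linear_add linear_cmul)

text \<open>Image, under the adjoint of \<open>D\<close>, of the semidefinite multipliers
  complementary to \<open>F\<close>. The adjoint is expressed by testing against all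
  \<open>d\<close>.\<close>

definition multiplier_cone ::
  "'i set \<Rightarrow> ('i \<Rightarrow> real ^ 'k ^ 'k) \<Rightarrow> ('i \<Rightarrow> 'x::euclidean_space \<Rightarrow> real ^ 'k ^ 'k) \<Rightarrow> 'x set" where
  "multiplier_cone I F D = {q. \<exists>Y. (\<forall>i\<in>I. pos_semidef (Y i) \<and> trace (Y i ** F i) = 0) \<and>
     (\<forall>d. q \<bullet> d = (\<Sum>i\<in>I. trace (Y i ** D i d)))}"

lemma convex_cone_multiplier_cone: "convex_cone (multiplier_cone I F D)"
  unfolding convex_cone_iff
proof (intro conjI ballI allI impI)
  show "0 \<in> multiplier_cone I F D"
    unfolding multiplier_cone_def by (auto intro!: exI[of _ "\<lambda>_. 0"] simp: pos_semidef_0 trace_zero)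
next
  fix q q' assume "q \<in> multiplier_cone I F D" "q' \<in> multiplier_cone I F D"
  then obtain Y Y' where "\<forall>i\<in>I. pos_semidef (Y i) \<and> trace (Y i ** F i) = 0"
    "\<forall>d. q \<bullet> d = (\<Sum>i\<in>I. trace (Y i ** D i d))"
    "\<forall>i\<in>I. pos_semidef (Y' i) \<and> trace (Y' i ** F i) = 0"
    "\<forall>d. q' \<bullet> d = (\<Sum>i\<in>I. trace (Y' i ** D i d))"
    unfolding multiplier_cone_def by blast
  then show "q + q' \<in> multiplier_cone I F D"
    unfolding multiplier_cone_def
    by (auto intro!: exI[of _ "\<lambda>i. Y i + Y' i"]
        simp: pos_semidef_add matrix_add_rdistrib trace_add sum.distrib inner_add_left)
next
  fix q and r :: real assume "q \<in> multiplier_cone I F D" "0 \<le> r"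
  then obtain Y where "\<forall>i\<in>I. pos_semidef (Y i) \<and> trace (Y i ** F i) = 0"
    "\<forall>d. q \<bullet> d = (\<Sum>i\<in>I. trace (Y i ** D i d))"
    unfolding multiplier_cone_def by blast
  then show "r *\<^sub>R q \<in> multiplier_cone I F D"
    unfolding multiplier_cone_def using \<open>0 \<le> r\<close>
    by (auto intro!: exI[of _ "\<lambda>i. r *\<^sub>R Y i"]
        simp: pos_semidef_scaleR scalar_matrix_assoc[symmetric] trace_scaleR sum_distrib_left)
qed

text \<open>Put \<open>u u^T\<close> at index \<open>i\<close> and zero at the others;
  complementarity holds because the form of \<open>F i\<close> vanishes at \<open>u\<close>.\<close>

lemma gradient_in_multiplier_cone:
  assumes "finite I" "i \<in> I" "qform (F i) u = 0" "linear (D i)"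
  shows "gradient (\<lambda>d. qform (D i d) u) \<in> multiplier_cone I F D"
proof -
  define U where "U = (\<chi> i j. u $ i * u $ j)"
  \<comment> \<open>Written with a one-column factor, \<open>U\<close> is a Gram matrix.\<close>
  have "U = (\<chi> i (j::unit). u $ i) ** transpose (\<chi> i j. u $ i)"
    by (simp add: U_def matrix_matrix_mult_def transpose_def vec_eq_iff UNIV_unit)
  then have psd: "pos_semidef U" by (simp only: pos_semidef_gram)
  have tr: "trace (U ** M) = qform M u" for M
    unfolding U_def by (rule trace_gram_mult)
  have "(\<Sum>j\<in>I. trace ((if j = i then U else 0) ** D j d)) = qform (D i d) u" for d
    using assms by (subst sum.remove[of I i]) (auto simp: tr trace_zero intro!: sum.neutral)
  then show ?thesis
    unfolding multiplier_cone_def using assms psd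
    by (auto intro!: exI[of _ "\<lambda>j. if j = i then U else 0"]
        simp: inner_gradient linear_qform pos_semidef_0 tr trace_zero)
qed

lemma affine_sdp_kkt_point:
  fixes x :: "'x::euclidean_space"
    and F :: "'i \<Rightarrow> 'x \<Rightarrow> real ^ 'k ^ 'k" and G :: "'i \<Rightarrow> 'x \<Rightarrow> real ^ 'l ^ 'l"
  assumes "finite I" and "linear f"
    and F: "\<And>i y d. i \<in> I \<Longrightarrow> F i (y + d) = F i y + DF i d" "\<And>i. i \<in> I \<Longrightarrow> linear (DF i)"
    and G: "\<And>i y d. i \<in> I \<Longrightarrow> G i (y + d) = G i y + DG i d" "\<And>i. i \<in> I \<Longrightarrow> linear (DG i)"
    and sym: "\<And>i y. i \<in> I \<Longrightarrow> transpose (F i y) = F i y" "\<And>i y. i \<in> I \<Longrightarrow> transpose (G i y) = G i y"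
    and feas: "\<And>i. i \<in> I \<Longrightarrow> pos_semidef (F i x)" "\<And>i. i \<in> I \<Longrightarrow> pos_semidef (G i x)"
    and opt: "\<And>y. (\<And>i. i \<in> I \<Longrightarrow> pos_semidef (F i y)) \<Longrightarrow>
                (\<And>i. i \<in> I \<Longrightarrow> pos_semidef (G i y)) \<Longrightarrow> f y \<le> f x"
    and slater: "\<And>i u. i \<in> I \<Longrightarrow> u \<noteq> 0 \<Longrightarrow> 0 < qform (F i w) u"
                "\<And>i u. i \<in> I \<Longrightarrow> u \<noteq> 0 \<Longrightarrow> 0 < qform (G i w) u"
  shows "kkt_point f I F G x"
proof -
  \<comment> \<open>Semidefiniteness of \<open>F i (x + d)\<close> is the family of scalar conditions \<open>p + q \<bullet> d \<ge> 0\<close> indexed by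
    unit vectors \<open>u\<close>, with \<open>p = qform (F i x) u\<close>; the condition is active when \<open>p = 0\<close>.\<close>
  define CF where "CF = (\<Union>i\<in>I. (\<lambda>u. (qform (F i x) u, gradient (\<lambda>d. qform (DF i d) u))) ` sphere 0 1)"
  define CG where "CG = (\<Union>i\<in>I. (\<lambda>u. (qform (G i x) u, gradient (\<lambda>d. qform (DG i d) u))) ` sphere 0 1)"
  have cont: "continuous_on S (\<lambda>u. (qform M u, gradient (\<lambda>d. qform (D d) u)))"
    for S and M :: "real ^ 'b ^ 'b" and D :: "'x \<Rightarrow> real ^ 'b ^ 'b"
    unfolding gradient_def
    by (intro continuous_on_Pair continuous_on_sum continuous_on_scaleR continuous_on_qform
        continuous_on_id continuous_on_const)
  have "compact CF" "compact CG"
    unfolding CF_def CG_def using \<open>finite I\<close>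
    by (auto intro!: compact_UN compact_continuous_image cont)
  then have "compact (CF \<union> CG)" by (rule compact_Un)
  have eqF: "qform (F i x) u + gradient (\<lambda>d. qform (DF i d) u) \<bullet> d = qform (F i (x + d)) u"
    if "i \<in> I" for i u d using F that by (simp add: inner_gradient linear_qform)
  have eqG: "qform (G i x) u + gradient (\<lambda>d. qform (DG i d) u) \<bullet> d = qform (G i (x + d)) u"
    if "i \<in> I" for i u d using G that by (simp add: inner_gradient linear_qform)
  let ?e = "gradient f"
  have "- ?e \<in> convex_cone hull {q. (0, q) \<in> CF \<union> CG}"
  proof (rule semi_infinite_multiplier[where w = "w - x"])
    show "compact (CF \<union> CG)" by fact
    show "0 \<le> p" if "(p, q) \<in> CF \<union> CG" for p q
      using that feas by (auto simp: CF_def CG_def qform_nonneg)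
    show "0 < p + q \<bullet> (w - x)" if "(p, q) \<in> CF \<union> CG" for p q
    proof -
      from that consider i u where "i \<in> I" "norm u = 1" "p = qform (F i x) u"
          "q = gradient (\<lambda>d. qform (DF i d) u)"
        | i u where "i \<in> I" "norm u = 1" "p = qform (G i x) u"
          "q = gradient (\<lambda>d. qform (DG i d) u)"
        unfolding CF_def CG_def by auto
      then show ?thesis
      proof cases
        case 1
        then show ?thesis using eqF[of i u "w - x"] slater(1)[of i u] by (cases "u = 0") auto
      next
        case 2
        then show ?thesis using eqG[of i u "w - x"] slater(2)[of i u] by (cases "u = 0") auto
      qed
    qed
    fix d assume *: "\<And>p q. (p, q) \<in> CF \<union> CG \<Longrightarrow> 0 \<le> p + q \<bullet> d"
    have "f (x + d) \<le> f x"
    proof (rule opt)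
      fix i assume "i \<in> I"
      show "pos_semidef (F i (x + d))"
        unfolding pos_semidef_iff_qform_sphere
      proof (intro conjI ballI)
        fix u :: "real ^ 'k" assume "u \<in> sphere 0 1"
        then show "0 \<le> qform (F i (x + d)) u"
          using *[of "qform (F i x) u" "gradient (\<lambda>d. qform (DF i d) u)"] \<open>i \<in> I\<close>
            eqF[OF \<open>i \<in> I\<close>, of u d] by (force simp: CF_def)
      qed (use sym \<open>i \<in> I\<close> in auto)
      show "pos_semidef (G i (x + d))"
        unfolding pos_semidef_iff_qform_sphere
      proof (intro conjI ballI)
        fix u :: "real ^ 'l" assume "u \<in> sphere 0 1"
        then show "0 \<le> qform (G i (x + d)) u"
          using *[of "qform (G i x) u" "gradient (\<lambda>d. qform (DG i d) u)"] \<open>i \<in> I\<close>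
            eqG[OF \<open>i \<in> I\<close>, of u d] by (force simp: CG_def)
      qed (use sym \<open>i \<in> I\<close> in auto)
    qed
    then show "?e \<bullet> d \<le> 0"
      using \<open>linear f\<close> by (simp add: inner_gradient linear_add)
  qed
  \<comment> \<open>The sum of the two multiplier cones is again a convex cone, so it suffices to
    place each active gradient in one summand and take 0 in the other.\<close>
  also have "\<dots> \<subseteq> {a + b | a b. a \<in> multiplier_cone I (\<lambda>i. F i x) DF \<and> b \<in> multiplier_cone I (\<lambda>i. G i x) DG}"
    (is "_ \<subseteq> ?M")
  proof (rule hull_minimal)
    have M: "?M = (\<Union>a\<in>multiplier_cone I (\<lambda>i. F i x) DF. \<Union>b\<in>multiplier_cone I (\<lambda>i. G i x) DG. {a + b})"
      by blast
    show "convex_cone ?M"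
      unfolding M by (intro convex_cone_sums convex_cone_multiplier_cone)
    have zero: "0 \<in> multiplier_cone I (\<lambda>i. F i x) DF" "0 \<in> multiplier_cone I (\<lambda>i. G i x) DG"
      by (simp_all add: convex_cone_contains_0 convex_cone_multiplier_cone)
    have "q \<in> ?M" if "(0, q) \<in> CF" for q
    proof -
      from that have "q \<in> multiplier_cone I (\<lambda>i. F i x) DF"
        unfolding CF_def using F(2) \<open>finite I\<close> by (auto intro!: gradient_in_multiplier_cone)
      then show ?thesis using zero by force
    qed
    moreover have "q \<in> ?M" if "(0, q) \<in> CG" for q
    proof -
      from that have "q \<in> multiplier_cone I (\<lambda>i. G i x) DG"
        unfolding CG_def using G(2) \<open>finite I\<close> by (auto intro!: gradient_in_multiplier_cone)
      then show ?thesis using zero by force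
    qed
    ultimately show "{q. (0, q) \<in> CF \<union> CG} \<subseteq> ?M" by blast
  qed
  finally obtain a b where ab: "- ?e = a + b"
      "a \<in> multiplier_cone I (\<lambda>i. F i x) DF" "b \<in> multiplier_cone I (\<lambda>i. G i x) DG"
    by blast
  from ab(2,3) obtain Y Z where Y: "\<forall>i\<in>I. pos_semidef (Y i) \<and> trace (Y i ** F i x) = 0"
      and Yd: "\<And>d. a \<bullet> d = (\<Sum>i\<in>I. trace (Y i ** DF i d))"
      and Z: "\<forall>i\<in>I. pos_semidef (Z i) \<and> trace (Z i ** G i x) = 0"
      and Zd: "\<And>d. b \<bullet> d = (\<Sum>i\<in>I. trace (Z i ** DG i d))"
    unfolding multiplier_cone_def by blast
  \<comment> \<open>All data are affine and the relation \<open>ab(1)\<close> cancels the linear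
    parts, so the Lagrangian is constant.\<close>
  have "f y + (\<Sum>i\<in>I. trace (Y i ** F i y)) + (\<Sum>i\<in>I. trace (Z i ** G i y)) = f x" for y
  proof -
    have "(\<Sum>i\<in>I. trace (Y i ** F i y)) = a \<bullet> (y - x)"
      unfolding Yd using F(1)[of _ x "y - x"] Y
      by (intro sum.cong) (auto simp: matrix_add_ldistrib trace_add)
    moreover have "(\<Sum>i\<in>I. trace (Z i ** G i y)) = b \<bullet> (y - x)"
      unfolding Zd using G(1)[of _ x "y - x"] Z
      by (intro sum.cong) (auto simp: matrix_add_ldistrib trace_add)
    moreover have "f (y - x) + a \<bullet> (y - x) + b \<bullet> (y - x) = 0"
      using arg_cong[OF ab(1), of "\<lambda>z. z \<bullet> (y - x)"] \<open>linear f\<close>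
      by (simp add: inner_gradient inner_add_left)
    ultimately show ?thesis
      using \<open>linear f\<close> by (simp add: linear_diff)
  qed
  then have "((\<lambda>y. f y + (\<Sum>i\<in>I. trace (Y i ** F i y)) + (\<Sum>i\<in>I. trace (Z i ** G i y)))
      has_derivative (\<lambda>_. 0)) (at x)"
    by simp
  then show ?thesis
    unfolding kkt_point_def using feas Y Z by blast
qed

section \<open>The convex--concave procedure\<close>

lemma mat_eq_scaleR: "mat r = r *\<^sub>R (mat 1 :: real ^ 'k ^ 'k)"
  by (simp add: mat_def vec_eq_iff)

lemma pos_semidef_nth_nonneg: "pos_semidef M \<Longrightarrow> 0 \<le> M $ q $ q"
  using qform_nonneg[of M "axis q 1 + 0 *\<^sub>R axis q 1"] by (simp add: qform_two_axes del: scaleR_zero_left)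

text \<open>A point is \<open>x = (\<alpha>, \<beta>, c)\<close>. The linearization of \<open>c\<^sup>2\<close> at \<open>ck\<close> is a lower bound because
  \<open>c\<^sup>2 - (2 * ck * c - ck\<^sup>2) = (c - ck)\<^sup>2\<close>, and the gap vanishes to second order at \<open>c = ck\<close>; this
  drives both the monotonicity and the transfer of the KKT conditions.\<close>

locale convex_concave =
  fixes I :: "'i set" and S0 E1 E2 :: "real ^ 'k ^ 'k" and \<kappa> :: "'i \<Rightarrow> real"
    and T0 T1 :: "'i \<Rightarrow> real ^ 'l ^ 'l" and q :: 'k
  assumes finite_I: "finite I" and I_nonempty: "I \<noteq> {}"
    and sym: "transpose S0 = S0" "transpose E2 = E2" "\<And>i. transpose (T0 i) = T0 i" "\<And>i. transpose (T1 i) = T1 i"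
    and E1: "pos_semidef E1" and \<kappa>: "\<And>i. 0 \<le> \<kappa> i"
    and corner: "E1 $ q $ q = 0" "E2 $ q $ q = 0"
begin

text \<open>Quadratic and linearized constraints share this pencil and differ only in the
  coefficient \<open>t\<close> of \<open>E1\<close>.\<close>

definition S :: "('i \<Rightarrow> real) \<Rightarrow> 'i \<Rightarrow> real \<times> real \<times> real \<Rightarrow> real ^ 'k ^ 'k" where
  "S t i x = S0 + t i *\<^sub>R E1 + fst (snd x) *\<^sub>R E2 - fst x *\<^sub>R mat 1"

definition Sq :: "'i \<Rightarrow> real \<times> real \<times> real \<Rightarrow> real ^ 'k ^ 'k" where
  "Sq i x = S (\<lambda>i. (snd (snd x))\<^sup>2 * \<kappa> i) i x"

definition Sl :: "real \<Rightarrow> 'i \<Rightarrow> real \<times> real \<times> real \<Rightarrow> real ^ 'k ^ 'k" where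
  "Sl ck i x = S (\<lambda>i. (2 * ck * snd (snd x) - ck\<^sup>2) * \<kappa> i) i x"

definition T :: "'i \<Rightarrow> real \<times> real \<times> real \<Rightarrow> real ^ 'l ^ 'l" where
  "T i x = T0 i + fst (snd x) *\<^sub>R mat 1 + snd (snd x) *\<^sub>R T1 i"

definition feasible :: "real \<Rightarrow> real \<times> real \<times> real \<Rightarrow> bool" where
  "feasible ck x \<longleftrightarrow> (\<forall>i\<in>I. pos_semidef (Sl ck i x) \<and> pos_semidef (T i x))"

definition iterates :: "(nat \<Rightarrow> real \<times> real \<times> real) \<Rightarrow> bool" where
  "iterates X \<longleftrightarrow> (\<forall>k. is_arg_max fst (feasible (snd (snd (X k)))) (X (Suc k)))"

lemma sym_S: "transpose (S t i x) = S t i x"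
  using E1 by (simp add: S_def transpose_add transpose_diff transpose_scalar sym pos_semidef_def)

lemma sym_T: "transpose (T i x) = T i x"
  by (simp add: T_def transpose_add transpose_scalar sym)

lemma Sq_eq_Sl: "Sq i x = Sl ck i x + ((snd (snd x) - ck)\<^sup>2 * \<kappa> i) *\<^sub>R E1"
  by (simp add: Sq_def Sl_def S_def algebra_simps power2_eq_square)

text \<open>Linearizing at the point's own gain is exact there, so
  \<open>feasible (snd (snd x)) x\<close> expresses feasibility for the non-convex problem.\<close>

lemma feasible_own: "feasible (snd (snd x)) x \<longleftrightarrow> (\<forall>i\<in>I. pos_semidef (Sq i x) \<and> pos_semidef (T i x))"
  by (simp add: feasible_def Sq_eq_Sl[of _ x "snd (snd x)"])

lemma feasible_imp_feasible_own: "feasible ck x \<Longrightarrow> feasible (snd (snd x)) x"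
  unfolding feasible_own unfolding feasible_def Sq_eq_Sl[of _ x ck]
  using E1 \<kappa> by (auto intro!: pos_semidef_add pos_semidef_scaleR mult_nonneg_nonneg)

lemma closed_feasible: "closed {x. feasible ck x}"
  unfolding feasible_def Sl_def S_def T_def Ball_def
  by (intro closed_Collect_all closed_Collect_imp closed_Collect_conj open_Collect_const
      closed_pos_semidef_preimage continuous_intros)

lemma closed_feasible_own: "closed {x. feasible (snd (snd x)) x}"
  unfolding feasible_own Sq_def S_def T_def Ball_def
  by (intro closed_Collect_all closed_Collect_imp closed_Collect_conj open_Collect_const
      closed_pos_semidef_preimage continuous_intros)

text \<open>At the diagonal position \<open>q\<close> the matrices \<open>E1\<close> and
  \<open>E2\<close> vanish, leaving \<open>S0 $ q $ q - fst x\<close>, which must be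
  nonnegative.\<close>

lemma objective_bounded: "feasible ck x \<Longrightarrow> fst x \<le> S0 $ q $ q"
proof -
  assume "feasible ck x"
  moreover obtain i where "i \<in> I" using I_nonempty by blast
  ultimately have "0 \<le> Sl ck i x $ q $ q" by (simp add: feasible_def pos_semidef_nth_nonneg)
  then show ?thesis by (simp add: Sl_def S_def corner mat_def)
qed

text \<open>A large \<open>\<beta>\<close> makes every \<open>T\<close> definite. As
  \<open>T\<close> does not involve the objective variable, a very negative value of it then makes
  every \<open>Sl\<close> definite as well.\<close>

lemma slater_point:
  obtains x where "\<And>i u. i \<in> I \<Longrightarrow> u \<noteq> 0 \<Longrightarrow> 0 < qform (Sl ck i x) u"
    and "\<And>i u. i \<in> I \<Longrightarrow> u \<noteq> 0 \<Longrightarrow> 0 < qform (T i x) u"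
proof -
  obtain \<beta> where \<beta>: "\<forall>i\<in>I. \<forall>u. u \<noteq> 0 \<longrightarrow> 0 < qform (T0 i + mat \<beta>) u"
    using eventually_happens'[OF trivial_limit_at_top_linorder eventually_diagonal_dominates[OF finite_I, of T0]]
    by meson
  obtain \<alpha> where \<alpha>: "\<forall>i\<in>I. \<forall>u. u \<noteq> 0 \<longrightarrow> 0 < qform (Sl ck i (0, \<beta>, 0) + mat \<alpha>) u"
    using eventually_happens'[OF trivial_limit_at_top_linorder
        eventually_diagonal_dominates[OF finite_I, of "\<lambda>i. Sl ck i (0, \<beta>, 0)"]]
    by meson
  show thesis
  proof
    show "0 < qform (Sl ck i (- \<alpha>, \<beta>, 0)) u" if "i \<in> I" "u \<noteq> 0" for i u
      using \<alpha> that by (simp add: Sl_def S_def)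
    show "0 < qform (T i (- \<alpha>, \<beta>, 0)) u" if "i \<in> I" "u \<noteq> 0" for i u
      using \<beta> that by (simp add: T_def)
  qed
qed

lemma feasible_exists: "\<exists>x. feasible ck x"
proof -
  obtain x where x: "\<And>i u. i \<in> I \<Longrightarrow> u \<noteq> 0 \<Longrightarrow> 0 < qform (Sl ck i x) u"
      "\<And>i u. i \<in> I \<Longrightarrow> u \<noteq> 0 \<Longrightarrow> 0 < qform (T i x) u"
    using slater_point by blast
  have "0 \<le> qform (Sl ck i x) u" "0 \<le> qform (T i x) v" if "i \<in> I" for i u v
    using x(1)[OF that, of u] x(2)[OF that, of v] by (cases "u = 0"; cases "v = 0"; simp)+
  then have "feasible ck x"
    unfolding feasible_def pos_semidef_iff_qform by (simp add: sym_T) (simp add: Sl_def sym_S)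
  then show ?thesis by blast
qed

text \<open>The feasible set may be unbounded, so the hypothesis only asks that each feasible
  objective value above a threshold be reached with bounded \<open>\<beta>\<close> and
  \<open>c\<close>. With \<open>objective_bounded\<close> this reduces the maximum to a compact
  set.\<close>

lemma subproblem_attained:
  assumes "\<And>\<alpha>0. \<exists>b. \<forall>x. feasible ck x \<and> \<alpha>0 \<le> fst x \<longrightarrow>
    (\<exists>\<beta> c. feasible ck (fst x, \<beta>, c) \<and> \<bar>\<beta>\<bar> \<le> b \<and> \<bar>c\<bar> \<le> b)"
  shows "\<exists>x. is_arg_max fst (feasible ck) x"
proof -
  obtain x0 where x0: "feasible ck x0" using feasible_exists by blast
  obtain b where b: "\<And>x. feasible ck x \<Longrightarrow> fst x0 \<le> fst x \<Longrightarrow>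
      \<exists>\<beta> c. feasible ck (fst x, \<beta>, c) \<and> \<bar>\<beta>\<bar> \<le> b \<and> \<bar>c\<bar> \<le> b"
    using assms[of "fst x0"] by blast
  define K where "K = {fst x0..S0 $ q $ q} \<times> {-b..b} \<times> {-b..b} \<inter> {x. feasible ck x}"
  have inK: "\<exists>\<beta> c. (fst x, \<beta>, c) \<in> K" if x: "feasible ck x" "fst x0 \<le> fst x" for x
  proof -
    obtain \<beta> c where "feasible ck (fst x, \<beta>, c)" "\<bar>\<beta>\<bar> \<le> b" "\<bar>c\<bar> \<le> b" using b[OF x] by blast
    then have "(fst x, \<beta>, c) \<in> K"
      using x(2) objective_bounded[OF x(1)] by (auto simp: K_def)
    then show ?thesis by blast
  qed
  have "compact K"
    unfolding K_def by (intro compact_Int_closed closed_feasible compact_Times) auto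
  moreover have "K \<noteq> {}" using inK[OF x0] by blast
  ultimately obtain x where x: "x \<in> K" "\<And>y. y \<in> K \<Longrightarrow> fst y \<le> fst x"
    using continuous_attains_sup[of K fst] continuous_on_fst[OF continuous_on_id] by blast
  have "fst y \<le> fst x" if "feasible ck y" for y
  proof (cases "fst x0 \<le> fst y")
    case True
    then show ?thesis using inK[OF that] x(2) by force
  next
    case False
    then show ?thesis using x(1) by (auto simp: K_def)
  qed
  moreover have "feasible ck x" using x(1) by (simp add: K_def)
  ultimately show ?thesis unfolding is_arg_max_def by (meson not_less)
qed

text \<open>Evaluate the form at \<open>axis p 1 + \<sigma> *\<^sub>R axis q 1\<close>. The cross
  term scales with the free weight \<open>s\<close>, while the contribution of \<open>E1\<close>
  sits in entry \<open>(p, p)\<close> alone; a large \<open>s\<close> thus lets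
  \<open>\<beta>\<close> outweigh \<open>c\<close>.\<close>

lemma offdiagonal_bound:
  assumes "feasible ck x" "i \<in> I" "\<alpha>0 \<le> fst x" "0 < s"
    and entries: "S0 $ p $ q = 0" "E1 $ p $ q = 0" "E2 $ p $ p = 0" "E2 $ p $ q \<noteq> 0"
  shows "2 * s * \<bar>fst (snd x)\<bar> * \<bar>E2 $ p $ q\<bar> \<le>
    (S0 $ p $ p - \<alpha>0) + s\<^sup>2 * (S0 $ q $ q - \<alpha>0) + 2 * \<bar>ck\<bar> * \<kappa> i * E1 $ p $ p * \<bar>snd (snd x)\<bar>"
proof -
  obtain \<alpha> \<beta> c where x: "x = (\<alpha>, \<beta>, c)" by (cases x)
  have "p \<noteq> q" using entries by auto
  have swap: "M $ q $ p = M $ p $ q" if "transpose M = M" for M :: "real ^ 'k ^ 'k"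
    using that by (metis column_transpose transpose_def vec_lambda_beta)
  define m where "m = E2 $ p $ q"
  \<comment> \<open>The sign makes the cross term equal to minus its absolute value, whatever the
    sign of \<open>\<beta>\<close>.\<close>
  define \<sigma> where "\<sigma> = (if 0 \<le> \<beta> * m then - s else s)"
  define t where "t = (2 * ck * c - ck\<^sup>2) * \<kappa> i"
  have E1pp: "0 \<le> E1 $ p $ p" using E1 by (rule pos_semidef_nth_nonneg)
  have "0 \<le> qform (Sl ck i x) (axis p 1 + \<sigma> *\<^sub>R axis q 1)"
    using assms by (simp add: feasible_def qform_nonneg)
  also have "\<dots> = S0 $ p $ p + t * E1 $ p $ p - \<alpha> + 2 * (\<sigma> * \<beta> * m) + \<sigma>\<^sup>2 * (S0 $ q $ q - \<alpha>)"
    unfolding qform_two_axes using entries corner \<open>p \<noteq> q\<close> swap[OF sym(1)] swap[OF sym(2)] swap[of E1] E1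
    by (simp add: x Sl_def S_def mat_def m_def t_def pos_semidef_def)
  also have "\<sigma> * \<beta> * m = - (s * \<bar>\<beta>\<bar> * \<bar>m\<bar>)"
    by (simp add: \<sigma>_def abs_mult[symmetric] mult.assoc)
  also have "\<sigma>\<^sup>2 = s\<^sup>2" by (simp add: \<sigma>_def)
  finally have "2 * (s * \<bar>\<beta>\<bar> * \<bar>m\<bar>) \<le> S0 $ p $ p + t * E1 $ p $ p - \<alpha> + s\<^sup>2 * (S0 $ q $ q - \<alpha>)"
    by simp
  moreover have "s\<^sup>2 * (S0 $ q $ q - \<alpha>) \<le> s\<^sup>2 * (S0 $ q $ q - \<alpha>0)"
    using assms(3) x by (intro mult_left_mono) auto
  moreover have "t * E1 $ p $ p \<le> 2 * \<bar>ck\<bar> * \<kappa> i * E1 $ p $ p * \<bar>c\<bar>"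
  proof -
    have "2 * ck * c - ck\<^sup>2 \<le> 2 * \<bar>ck\<bar> * \<bar>c\<bar>"
      using abs_ge_self[of "ck * c"] zero_le_power2[of ck] by (simp only: abs_mult mult.assoc)
    then have "t * E1 $ p $ p \<le> (2 * \<bar>ck\<bar> * \<bar>c\<bar>) * \<kappa> i * E1 $ p $ p"
      unfolding t_def using \<kappa> E1pp by (intro mult_right_mono) auto
    then show ?thesis by (simp add: mult_ac)
  qed
  ultimately show ?thesis using assms(3) by (simp add: x m_def mult_ac)
qed

text \<open>Two opposing estimates: \<open>T\<close> forces \<open>\<beta>\<close> to grow at least
  like \<open>l * \<bar>c\<bar>\<close>, and the off-diagonal test gives \<open>(K + 1) / l *
  \<bar>\<beta>\<bar> \<le> A + K * \<bar>c\<bar>\<close>. Combined, one copy of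
  \<open>\<bar>c\<bar>\<close> survives on the left, which bounds \<open>c\<close> and then
  \<open>\<beta>\<close>.\<close>

lemma feasible_bounded:
  assumes "i \<in> I" "0 < l" and T: "\<And>x. pos_semidef (T i x) \<Longrightarrow> l * \<bar>snd (snd x)\<bar> - 1 \<le> fst (snd x)"
    and entries: "S0 $ p $ q = 0" "E1 $ p $ q = 0" "E2 $ p $ p = 0" "E2 $ p $ q \<noteq> 0"
  shows "\<exists>b. \<forall>x. feasible ck x \<and> \<alpha>0 \<le> fst x \<longrightarrow> \<bar>fst (snd x)\<bar> \<le> b \<and> \<bar>snd (snd x)\<bar> \<le> b"
proof -
  define K where "K = 2 * \<bar>ck\<bar> * \<kappa> i * E1 $ p $ p"
  have "K \<ge> 0"
    unfolding K_def using \<kappa> pos_semidef_nth_nonneg[OF E1] by (intro mult_nonneg_nonneg) auto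
  \<comment> \<open>chosen so that the off-diagonal term of the test vector outgrows the linear term \<open>K * \<bar>c\<bar>\<close>\<close>
  define s where "s = (K + 1) / (2 * l * \<bar>E2 $ p $ q\<bar>)"
  have s: "2 * s * \<bar>E2 $ p $ q\<bar> = (K + 1) / l" "0 < s"
    using \<open>0 < l\<close> \<open>K \<ge> 0\<close> entries(4) by (simp_all add: s_def field_simps)
  define A where "A = (S0 $ p $ p - \<alpha>0) + s\<^sup>2 * (S0 $ q $ q - \<alpha>0)"
  define C where "C = A + (K + 1) / l"
  have "\<bar>snd (snd x)\<bar> \<le> C \<and> \<bar>fst (snd x)\<bar> \<le> l * (A + K * C) / (K + 1)"
    if x: "feasible ck x" "\<alpha>0 \<le> fst x" for x
  proof -
    have "2 * s * \<bar>fst (snd x)\<bar> * \<bar>E2 $ p $ q\<bar> \<le> A + K * \<bar>snd (snd x)\<bar>"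
      using offdiagonal_bound[OF x(1) assms(1) x(2) s(2) entries] by (simp add: A_def K_def)
    then have *: "(K + 1) / l * \<bar>fst (snd x)\<bar> \<le> A + K * \<bar>snd (snd x)\<bar>"
      unfolding s(1)[symmetric] by (simp add: mult_ac)
    have "l * \<bar>snd (snd x)\<bar> - 1 \<le> \<bar>fst (snd x)\<bar>"
      using T[of x] x(1) assms(1) by (force simp: feasible_def)
    then have "(K + 1) / l * (l * \<bar>snd (snd x)\<bar> - 1) \<le> (K + 1) / l * \<bar>fst (snd x)\<bar>"
      using \<open>K \<ge> 0\<close> \<open>0 < l\<close> by (intro mult_left_mono) auto
    also have "(K + 1) / l * (l * \<bar>snd (snd x)\<bar> - 1) = (K + 1) * \<bar>snd (snd x)\<bar> - (K + 1) / l"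
      using \<open>0 < l\<close> by (simp add: field_simps)
    finally have c: "\<bar>snd (snd x)\<bar> \<le> C"
      using * by (simp add: C_def algebra_simps)
    then have "(K + 1) / l * \<bar>fst (snd x)\<bar> \<le> A + K * C"
      using * mult_left_mono[OF c \<open>K \<ge> 0\<close>] by linarith
    then show ?thesis
      using c \<open>K \<ge> 0\<close> \<open>0 < l\<close> by (simp add: field_simps)
  qed
  then show ?thesis
    by (intro exI[of _ "max C (l * (A + K * C) / (K + 1))"]) (auto simp: le_max_iff_disj)
qed

section \<open>Existence of iterates and monotonicity of the objective\<close>

lemma iterates_exist:
  assumes "\<And>ck. \<exists>x. is_arg_max fst (feasible ck) x"
  shows "\<exists>X. snd (snd (X 0)) = c0 \<and> iterates X"
proof -
  obtain sol where sol: "\<And>ck. is_arg_max fst (feasible ck) (sol ck)" using assms by metis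
  \<comment> \<open>Only the gain of the start is prescribed; the zeros are placeholders.\<close>
  define X where "X = rec_nat (0, 0, c0) (\<lambda>_ x. sol (snd (snd x)))"
  have "snd (snd (X 0)) = c0 \<and> iterates X"
    by (simp add: X_def iterates_def sol)
  then show ?thesis by blast
qed

lemma iterates_optimal:
  assumes "iterates X"
  shows "feasible (snd (snd (X k))) (X (Suc k))"
    and "feasible (snd (snd (X k))) y \<Longrightarrow> fst y \<le> fst (X (Suc k))"
proof -
  have "is_arg_max fst (feasible (snd (snd (X k)))) (X (Suc k))"
    using assms by (simp add: iterates_def)
  then show "feasible (snd (snd (X k))) (X (Suc k))"
    and "feasible (snd (snd (X k))) y \<Longrightarrow> fst y \<le> fst (X (Suc k))"
    unfolding is_arg_max_def by (blast, meson not_less)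
qed

text \<open>Index 0 is excluded because the initial point is arbitrary; from 1 on, feasibility for
  the previous subproblem carries over.\<close>

lemma iterates_feasible_own:
  assumes "iterates X" "1 \<le> k" shows "feasible (snd (snd (X k))) (X k)"
  using assms iterates_optimal(1)[of X "k - 1"] feasible_imp_feasible_own by simp

lemma objective_mono_Suc:
  assumes "iterates X" "1 \<le> k" shows "fst (X k) \<le> fst (X (Suc k))"
  using assms by (intro iterates_optimal(2) iterates_feasible_own)

lemma objective_mono:
  assumes "iterates X" "1 \<le> j" "j \<le> k" shows "fst (X j) \<le> fst (X k)"
  using assms(3,2)
proof (induction rule: dec_induct)
  case (step n)
  then show ?case using objective_mono_Suc[OF assms(1), of n] by simp
qed simp

lemma objective_convergent:
  assumes "iterates X" shows "convergent (\<lambda>k. fst (X k))"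
proof -
  have "incseq (\<lambda>k. fst (X (Suc k)))"
    using objective_mono_Suc[OF assms] by (intro incseq_SucI) simp
  moreover have "fst (X (Suc k)) \<le> S0 $ q $ q" for k
    using objective_bounded iterates_optimal(1)[OF assms] by blast
  ultimately have "convergent (\<lambda>k. fst (X (Suc k)))"
    using incseq_convergent by (metis convergentI)
  then show ?thesis using convergent_Suc_iff[of "\<lambda>k. fst (X k)"] by blast
qed

lemma limit_point_optimal:
  assumes "iterates X" "seq_limit_point X x"
  shows "feasible (snd (snd x)) x" and "feasible (snd (snd x)) y \<Longrightarrow> fst y \<le> fst x"
proof -
  obtain r where r: "strict_mono r" and lim: "(\<lambda>n. X (r n)) \<longlonglongrightarrow> x"
    using assms(2) by (auto simp: seq_limit_point_def o_def)
  have r_ge: "\<forall>\<^sub>F n in sequentially. k \<le> r n" for k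
    using filterlim_subseq[OF r] by (simp add: filterlim_at_top)
  have "\<forall>\<^sub>F n in sequentially. X (r n) \<in> {x. feasible (snd (snd x)) x}"
    using r_ge[of 1] by (rule eventually_mono) (simp add: iterates_feasible_own[OF assms(1)])
  then show "feasible (snd (snd x)) x"
    using Lim_in_closed_set[OF closed_feasible_own _ _ lim] by simp
  \<comment> \<open>Monotonicity extends the bound to iterates outside the subsequence, in
    particular to the successor of \<open>r n\<close>.\<close>
  have le: "fst (X k) \<le> fst x" if "1 \<le> k" for k
  proof (rule tendsto_lowerbound[OF tendsto_fst[OF lim]])
    show "\<forall>\<^sub>F n in sequentially. fst (X k) \<le> fst (X (r n))"
      using r_ge[of k] by (rule eventually_mono) (simp add: objective_mono[OF assms(1) that])
  qed simp
  assume y: "feasible (snd (snd x)) y"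
  show "fst y \<le> fst x"
  proof (rule ccontr)
    assume "\<not> fst y \<le> fst x"
    \<comment> \<open>lowering the objective of \<open>y\<close> a little keeps it feasible for all subproblems near the limit\<close>
    define e where "e = (fst y - fst x) / 2"
    have "e > 0" using \<open>\<not> fst y \<le> fst x\<close> by (simp add: e_def)
    define z where "z = (fst y - e, snd y)"
    obtain b where "b > 0" and b: "\<And>u. \<bar>qform E1 u\<bar> \<le> b * (norm u)\<^sup>2" using qform_bound by blast
    \<comment> \<open>Change of the tangent value at the gain of \<open>y\<close> when the
      linearization point moves from the limit to iterate \<open>r n\<close>.\<close>
    define \<delta> where "\<delta> n = 2 * snd (snd (X (r n))) * snd (snd y) - (snd (snd (X (r n))))\<^sup>2
      - (2 * snd (snd x) * snd (snd y) - (snd (snd x))\<^sup>2)" for n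
    have "\<delta> \<longlonglongrightarrow> 2 * snd (snd x) * snd (snd y) - (snd (snd x))\<^sup>2
        - (2 * snd (snd x) * snd (snd y) - (snd (snd x))\<^sup>2)"
      unfolding \<delta>_def by (intro tendsto_intros lim)
    then have \<delta>0: "\<delta> \<longlonglongrightarrow> 0" by simp
    \<comment> \<open>Below \<open>e / b\<close>, the perturbation of the form is absorbed by the
      \<open>e *\<^sub>R mat 1\<close> gained from lowering the objective.\<close>
    have "\<forall>\<^sub>F n in sequentially. \<forall>i\<in>I. \<bar>\<delta> n * \<kappa> i\<bar> < e / b"
      unfolding eventually_ball_finite_distrib[OF finite_I]
    proof
      fix i
      have "(\<lambda>n. \<delta> n * \<kappa> i) \<longlonglongrightarrow> 0" using tendsto_mult_left_zero[OF \<delta>0] by simp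
      then show "\<forall>\<^sub>F n in sequentially. \<bar>\<delta> n * \<kappa> i\<bar> < e / b"
        using \<open>e > 0\<close> \<open>b > 0\<close> by (auto dest!: tendstoD[where e = "e / b"] simp: dist_real_def)
    qed
    then obtain n where n: "\<And>i. i \<in> I \<Longrightarrow> \<bar>\<delta> n * \<kappa> i\<bar> < e / b"
      using eventually_happens'[OF sequentially_bot] by blast
    have "feasible (snd (snd (X (r n)))) z"
      unfolding feasible_def
    proof (intro ballI conjI)
      fix i assume "i \<in> I"
      have "T i z = T i y" by (simp add: T_def z_def)
      then show "pos_semidef (T i z)" using y \<open>i \<in> I\<close> by (simp add: feasible_def)
      have Sl: "Sl (snd (snd (X (r n)))) i z = Sl (snd (snd x)) i y + (\<delta> n * \<kappa> i) *\<^sub>R E1 + e *\<^sub>R mat 1"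
        by (simp add: Sl_def S_def z_def \<delta>_def algebra_simps)
      have "0 \<le> qform (Sl (snd (snd (X (r n)))) i z) u" for u
      proof -
        have "\<bar>\<delta> n * \<kappa> i * qform E1 u\<bar> \<le> e / b * (b * (norm u)\<^sup>2)"
          unfolding abs_mult[of "\<delta> n * \<kappa> i"]
          using n[OF \<open>i \<in> I\<close>] b[of u] \<open>e > 0\<close> \<open>b > 0\<close> by (intro mult_mono) auto
        then have "\<bar>\<delta> n * \<kappa> i * qform E1 u\<bar> \<le> e * (norm u)\<^sup>2" using \<open>b > 0\<close> by simp
        moreover have "0 \<le> qform (Sl (snd (snd x)) i y) u"
          using y \<open>i \<in> I\<close> by (simp add: feasible_def qform_nonneg)
        ultimately show ?thesis unfolding Sl by simp
      qed
      then show "pos_semidef (Sl (snd (snd (X (r n)))) i z)"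
        unfolding pos_semidef_iff_qform by (simp add: Sl_def sym_S)
    qed
    then have "fst z \<le> fst (X (Suc (r n)))" by (rule iterates_optimal(2)[OF assms(1)])
    also have "\<dots> \<le> fst x" by (rule le) simp
    finally show False using \<open>e > 0\<close> by (simp add: z_def e_def field_simps)
  qed
qed

lemma kkt_point_of_optimal:
  assumes feas: "feasible (snd (snd x)) x" and opt: "\<And>y. feasible (snd (snd x)) y \<Longrightarrow> fst y \<le> fst x"
  shows "kkt_point fst I Sq T x"
proof -
  let ?ck = "snd (snd x)"
  obtain w where w: "\<And>i u. i \<in> I \<Longrightarrow> u \<noteq> 0 \<Longrightarrow> 0 < qform (Sl ?ck i w) u"
      "\<And>i u. i \<in> I \<Longrightarrow> u \<noteq> 0 \<Longrightarrow> 0 < qform (T i w) u"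
    using slater_point by blast
  have "kkt_point fst I (Sl ?ck) T x"
  proof (rule affine_sdp_kkt_point[where w = w
        and DF = "\<lambda>i d. (2 * ?ck * snd (snd d) * \<kappa> i) *\<^sub>R E1 + fst (snd d) *\<^sub>R E2 - fst d *\<^sub>R mat 1"
        and DG = "\<lambda>i d. fst (snd d) *\<^sub>R mat 1 + snd (snd d) *\<^sub>R T1 i"])
    show "finite I" by (rule finite_I)
    show "linear fst" by (rule linear_fst)
    show "Sl ?ck i (y + d) = Sl ?ck i y
        + ((2 * ?ck * snd (snd d) * \<kappa> i) *\<^sub>R E1 + fst (snd d) *\<^sub>R E2 - fst d *\<^sub>R mat 1)" for i y d
      by (simp add: Sl_def S_def algebra_simps)
    show "linear (\<lambda>d. (2 * ?ck * snd (snd d) * \<kappa> i) *\<^sub>R E1 + fst (snd d) *\<^sub>R E2 - fst d *\<^sub>R mat 1)" for i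
      by (rule linearI) (simp_all add: algebra_simps)
    show "T i (y + d) = T i y + (fst (snd d) *\<^sub>R mat 1 + snd (snd d) *\<^sub>R T1 i)" for i y d
      by (simp add: T_def algebra_simps)
    show "linear (\<lambda>d. fst (snd d) *\<^sub>R mat 1 + snd (snd d) *\<^sub>R T1 i)" for i
      by (rule linearI) (simp_all add: algebra_simps)
    show "transpose (Sl ?ck i y) = Sl ?ck i y" "transpose (T i y) = T i y" for i y
      by (simp_all add: Sl_def sym_S sym_T)
    show "fst y \<le> fst x" if "\<And>i. i \<in> I \<Longrightarrow> pos_semidef (Sl ?ck i y)" "\<And>i. i \<in> I \<Longrightarrow> pos_semidef (T i y)" for y
      using that by (intro opt) (simp add: feasible_def)
  qed (use feas w in \<open>auto simp: feasible_def\<close>)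
  then obtain Y Z where YZ: "\<forall>i\<in>I. pos_semidef (Y i) \<and> pos_semidef (Z i)"
      "\<forall>i\<in>I. trace (Y i ** Sl ?ck i x) = 0 \<and> trace (Z i ** T i x) = 0"
      and D: "((\<lambda>y. fst y + (\<Sum>i\<in>I. trace (Y i ** Sl ?ck i y)) + (\<Sum>i\<in>I. trace (Z i ** T i y)))
        has_derivative (\<lambda>_. 0)) (at x)"
    unfolding kkt_point_def by blast
  \<comment> \<open>The Lagrangians of the two problems differ by
    \<open>(snd (snd y) - ?ck)^2\<close> times this constant. The difference has zero derivative at
    \<open>x\<close>, so the same multipliers work.\<close>
  define w where "w = (\<Sum>i\<in>I. \<kappa> i * trace (Y i ** E1))"
  have "((\<lambda>y. (snd (snd y) - ?ck)\<^sup>2 * w) has_derivative (\<lambda>_. 0)) (at x)"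
    by (auto intro!: derivative_eq_intros)
  from has_derivative_add[OF D this]
  have D': "((\<lambda>y. fst y + (\<Sum>i\<in>I. trace (Y i ** Sl ?ck i y)) + (\<Sum>i\<in>I. trace (Z i ** T i y))
      + (snd (snd y) - ?ck)\<^sup>2 * w) has_derivative (\<lambda>_. 0)) (at x)" by simp
  have "trace (Y i ** Sq i y) = trace (Y i ** Sl ?ck i y) + (snd (snd y) - ?ck)\<^sup>2 * (\<kappa> i * trace (Y i ** E1))" for i y
    by (simp add: Sq_eq_Sl[of i y ?ck] matrix_add_ldistrib trace_add matrix_scalar_ac
        scalar_matrix_assoc[symmetric] trace_scaleR)
  then have "fst y + (\<Sum>i\<in>I. trace (Y i ** Sl ?ck i y)) + (\<Sum>i\<in>I. trace (Z i ** T i y)) + (snd (snd y) - ?ck)\<^sup>2 * w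
      = fst y + (\<Sum>i\<in>I. trace (Y i ** Sq i y)) + (\<Sum>i\<in>I. trace (Z i ** T i y))" for y
    by (simp add: w_def sum.distrib sum_distrib_left)
  then have "((\<lambda>y. fst y + (\<Sum>i\<in>I. trace (Y i ** Sq i y)) + (\<Sum>i\<in>I. trace (Z i ** T i y)))
      has_derivative (\<lambda>_. 0)) (at x)"
    using D' by (simp only:)
  moreover have "Sq i x = Sl ?ck i x" for i by (simp add: Sq_eq_Sl[of i x ?ck])
  ultimately show ?thesis
    unfolding kkt_point_def using YZ feas by (auto simp: feasible_def)
qed

theorem limit_point_kkt:
  "iterates X \<Longrightarrow> seq_limit_point X x \<Longrightarrow> kkt_point fst I Sq T x"
  by (intro kkt_point_of_optimal limit_point_optimal) auto

end

text \<open>Bolzano-Weierstrass, applied for the second claim to the indices at distance at least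
  \<open>e\<close> from \<open>Z\<close>: a limit point along them would lie in
  \<open>Z\<close>.\<close>

lemma bounded_seq_infdist_tendsto_0:
  fixes X :: "nat \<Rightarrow> 'a::euclidean_space"
  assumes bdd: "bounded (range X)" and lim: "\<And>x. seq_limit_point X x \<Longrightarrow> x \<in> Z"
  shows "\<exists>x. seq_limit_point X x" and "(\<lambda>k. infdist (X k) Z) \<longlonglongrightarrow> 0"
proof -
  have sub: "\<exists>x r. strict_mono r \<and> ((X \<circ> s) \<circ> r) \<longlonglongrightarrow> x" for s :: "nat \<Rightarrow> nat"
  proof -
    have "bounded (range (X \<circ> s))" using bdd by (rule bounded_subset) auto
    then show ?thesis using bounded_imp_convergent_subsequence by metis
  qed
  show "\<exists>x. seq_limit_point X x"
    using sub[of id] by (auto simp: seq_limit_point_def)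
  show "(\<lambda>k. infdist (X k) Z) \<longlonglongrightarrow> 0"
  proof (rule ccontr)
    assume "\<not> (\<lambda>k. infdist (X k) Z) \<longlonglongrightarrow> 0"
    then obtain e where "e > 0" and "\<exists>\<^sub>F k in sequentially. e \<le> infdist (X k) Z"
      by (auto simp: tendsto_iff frequently_def not_le infdist_nonneg)
    then have "\<exists>\<^sub>\<infinity>k. e \<le> infdist (X k) Z" by (simp add: cofinite_eq_sequentially)
    then have inf: "infinite {k. e \<le> infdist (X k) Z}" by (simp add: INFM_iff_infinite)
    define s where "s = enumerate {k. e \<le> infdist (X k) Z}"
    have s: "strict_mono s" "\<And>n. e \<le> infdist (X (s n)) Z"
      using inf enumerate_in_set[OF inf] by (auto simp: s_def strict_mono_enumerate)
    obtain x r where r: "strict_mono r" "((X \<circ> s) \<circ> r) \<longlonglongrightarrow> x" using sub by blast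
    have "seq_limit_point X x"
      unfolding seq_limit_point_def using r s(1)
      by (intro exI[of _ "s \<circ> r"]) (auto simp: o_assoc strict_mono_o)
    then have "x \<in> Z" by (rule lim)
    have "\<forall>\<^sub>F n in sequentially. dist (((X \<circ> s) \<circ> r) n) x < e"
      using r(2) \<open>e > 0\<close> by (rule tendstoD)
    then obtain n where "dist (X (s (r n))) x < e"
      using eventually_happens'[OF sequentially_bot] by fastforce
    then show False using s(2)[of "r n"] infdist_le[OF \<open>x \<in> Z\<close>, of "X (s (r n))"] by simp
  qed
qed

section \<open>The coupling-gain problem\<close>

text \<open>The slope of \<open>N_mat\<close> in \<open>c\<close>: the off-diagonal entry
  \<open>(c * (cmod l)^2 - Re l) / cmod l\<close> grows by \<open>cmod l\<close> per unit of
  \<open>c\<close>.\<close>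

definition coupling_mat :: "complex \<Rightarrow> real ^ 2 ^ 2" where
  "coupling_mat l = vector [vector [0, cmod l], vector [cmod l, 0]]"

definition gain_block :: "real ^ ('n::finite + 'm::finite) ^ ('n + 'm) \<Rightarrow> real ^ ('n + 'm) ^ ('n + 'm)" where
  "gain_block H =
    block_mat (blk12 H ** (matrix_inv (blk22 H) ** matrix_inv (blk22 H)) ** transpose (blk12 H)) 0 0 0"

definition cross_block :: "real ^ ('n::finite + 'm::finite) ^ ('n + 'm) \<Rightarrow> real ^ ('n + 'm) ^ ('n + 'm)" where
  "cross_block H = block_mat 0 (blk12 H) (transpose (blk12 H)) 0"

text \<open>The case \<open>l = 0\<close> is included: division by zero yields 0, so the
  off-diagonal entries vanish, in agreement with \<open>coupling_mat 0\<close>.\<close>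

lemma N_mat_affine: "N_mat \<beta> c l = N_mat 0 0 l + \<beta> *\<^sub>R mat 1 + c *\<^sub>R coupling_mat l"
  by (simp add: N_mat_def coupling_mat_def Let_def vec_eq_iff forall_2 mat_def power2_eq_square algebra_simps)

lemma S_mat_affine:
  "S_mat Q \<gamma> H l t \<beta> = block_mat Q 0 0 (blk22 H) + (t * (\<gamma> * (cmod l)\<^sup>2)) *\<^sub>R gain_block H + \<beta> *\<^sub>R cross_block H"
  by (simp add: S_mat_def gain_block_def cross_block_def block_mat_def vec_eq_iff split: sum.split)

lemma transpose_block_mat:
  "transpose (block_mat M11 M12 M21 M22) = block_mat (transpose M11) (transpose M21) (transpose M12) (transpose M22)"
  by (simp add: block_mat_def transpose_def vec_eq_iff split: sum.split)

lemma transpose_0: "transpose 0 = (0 :: 'a::zero ^ 's ^ 'r)"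
  by (simp add: transpose_def vec_eq_iff)

lemma matrix_inv_symmetric:
  fixes M :: "real ^ 'k ^ 'k"
  assumes "transpose M = M" "invertible M" shows "transpose (matrix_inv M) = matrix_inv M"
proof -
  have inv: "M ** matrix_inv M = mat 1"
    using assms(2) unfolding invertible_def matrix_inv_def by (metis (mono_tags, lifting) someI_ex)
  then have "transpose (matrix_inv M) ** M = mat 1"
    using assms(1) matrix_transpose_mul[of M "matrix_inv M"] by (simp add: transpose_mat)
  with inv show ?thesis
    by (metis matrix_mul_assoc matrix_mul_lid matrix_mul_rid)
qed

text \<open>The inverse of the symmetric \<open>blk22 H\<close> is symmetric, so the upper left
  block factors as \<open>K ** transpose K\<close>.\<close>

lemma pos_semidef_gain_block:
  fixes H :: "real ^ ('n::finite + 'm::finite) ^ ('n + 'm)"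
  assumes "transpose (blk22 H) = blk22 H" "invertible (blk22 H)"
  shows "pos_semidef (gain_block H)"
proof -
  define K where "K = blk12 H ** matrix_inv (blk22 H)"
  \<comment> \<open>Zero rows extend \<open>K\<close> so that the whole block matrix becomes one
    Gram matrix.\<close>
  define L :: "real ^ 'm ^ ('n + 'm)" where "L = (\<chi> i j. case i of Inl r \<Rightarrow> K $ r $ j | Inr _ \<Rightarrow> 0)"
  have "blk12 H ** (matrix_inv (blk22 H) ** matrix_inv (blk22 H)) ** transpose (blk12 H) = K ** transpose K"
    using matrix_inv_symmetric[OF assms] by (simp add: K_def matrix_transpose_mul matrix_mul_assoc)
  then have "gain_block H = L ** transpose L"
    by (simp add: gain_block_def L_def block_mat_def matrix_matrix_mult_def transpose_def vec_eq_iff split: sum.split)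
  then show ?thesis by (simp add: pos_semidef_gram)
qed

text \<open>In the directions \<open>(1, 1)\<close> and \<open>(1, -1)\<close> the terms
  \<open>\<sigma>\<close> cancel, leaving \<open>\<bar>d\<bar> \<le> \<beta>\<close>. Since
  \<open>\<bar>Re l\<bar> \<le> cmod l\<close>, \<open>d\<close> differs from
  \<open>c * cmod l\<close> by at most 1.\<close>

lemma N_mat_pos_semidef_imp_le:
  assumes "pos_semidef (N_mat \<beta> c l)" shows "cmod l * \<bar>c\<bar> - 1 \<le> \<beta>"
proof -
  define d where "d = c * cmod l - Re l / cmod l"
  have d: "1 / cmod l * (c * (cmod l)\<^sup>2 - Re l) = d"
    by (cases "l = 0") (simp_all add: d_def power2_eq_square field_simps)
  define \<sigma> where "\<sigma> = sqrt (1 - (Re l)\<^sup>2 / (cmod l)\<^sup>2)"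
  have "0 \<le> \<beta> - \<sigma> + s * (d + d) + s\<^sup>2 * (\<beta> + \<sigma>)" for s
    using qform_nonneg[OF assms, of "axis 1 1 + s *\<^sub>R axis 2 1"]
    unfolding qform_two_axes by (simp add: N_mat_def Let_def \<sigma>_def d[symmetric])
  from this[of 1] this[of "-1"] have "\<bar>d\<bar> \<le> \<beta>" by simp
  moreover have "\<bar>Re l / cmod l\<bar> \<le> 1"
    by (cases "l = 0") (simp_all add: abs_Re_le_cmod)
  moreover have "\<bar>c * cmod l\<bar> = cmod l * \<bar>c\<bar>" by (simp add: abs_mult)
  ultimately show ?thesis unfolding d_def by linarith
qed

theorem theorem5:
  fixes A :: "real ^ 'n ^ 'n" and B :: "real ^ 'm ^ 'n"
    and a :: "real ^ 'v ^ 'v" and \<Lambda> :: "nat \<Rightarrow> complex"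
    and Q :: "real ^ 'n ^ 'n" and \<gamma> \<mu> :: real
    and H :: "real ^ ('n::finite + 'm::finite) ^ ('n::finite + 'm::finite)"
  assumes "controllable A B"
    and "CARD('v) \<ge> 2"
    and "\<forall>i j. a $ i $ j \<ge> 0"
    and "has_spanning_tree a"
    and "eigenvalue_list (cmat (laplacian a)) \<Lambda>" and "\<Lambda> 1 = 0"
    and "pos_semidef Q" and "\<gamma> > 0" and "\<mu> \<ge> 1"
    and "H_optimal A B Q \<gamma> \<mu> H" and "invertible (blk22 H)"
    and "\<exists>c>0. \<forall>i\<in>{2..CARD('v)}.
           pos_def_complex (cmat (P_of H) -
             conj_transpose (closed_loop A B (K_of H) \<mu> c (\<Lambda> i)) ** cmat (P_of H) **
               closed_loop A B (K_of H) \<mu> c (\<Lambda> i))"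
  shows "\<forall>c0::real.
    (\<exists>\<alpha> \<beta> c. c 0 = c0 \<and> ccp_iterates Q \<gamma> H \<Lambda> CARD('v) \<alpha> \<beta> c) \<and>
    (\<forall>\<alpha> \<beta> c. c 0 = c0 \<and> ccp_iterates Q \<gamma> H \<Lambda> CARD('v) \<alpha> \<beta> c \<longrightarrow>
      (\<forall>k\<ge>1. \<alpha> k \<le> \<alpha> (Suc k)) \<and>
      convergent \<alpha> \<and>
      (\<forall>x. seq_limit_point (\<lambda>k. (\<alpha> k, \<beta> k, c k)) x \<longrightarrow>
         stationary Q \<gamma> H \<Lambda> CARD('v) x) \<and>
      (bounded (range (\<lambda>k. (\<alpha> k, \<beta> k, c k))) \<longrightarrow>
         (\<exists>x. seq_limit_point (\<lambda>k. (\<alpha> k, \<beta> k, c k)) x) \<and>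
         (\<lambda>k. infdist (\<alpha> k, \<beta> k, c k) {x. stationary Q \<gamma> H \<Lambda> CARD('v) x}) \<longlonglongrightarrow> 0))"
proof -
  let ?S0 = "block_mat Q 0 0 (blk22 H)" and ?\<kappa> = "\<lambda>i. \<gamma> * (cmod (\<Lambda> i))\<^sup>2"
  have "transpose H = H"
    using \<open>H_optimal A B Q \<gamma> \<mu> H\<close> by (auto simp: H_optimal_def H_feasible_def is_arg_max_def)
  then have H22: "transpose (blk22 H) = blk22 H"
    by (simp add: blk22_def transpose_def vec_eq_iff)
  \<comment> \<open>\<open>j\<close> stays free: the boundedness argument takes the column of a nonzero entry of \<open>blk12 H\<close>.\<close>
  have cc: "convex_concave {2..CARD('v)} ?S0 (gain_block H) (cross_block H) ?\<kappa>
      (\<lambda>i. N_mat 0 0 (\<Lambda> i)) (\<lambda>i. coupling_mat (\<Lambda> i)) (Inr j)" for j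
  proof
    show "transpose ?S0 = ?S0"
      using \<open>pos_semidef Q\<close> H22 by (simp add: transpose_block_mat transpose_0 pos_semidef_def)
    show "transpose (cross_block H) = cross_block H"
      by (simp add: cross_block_def transpose_block_mat transpose_0)
    show "transpose (N_mat 0 0 (\<Lambda> i)) = N_mat 0 0 (\<Lambda> i)" "transpose (coupling_mat (\<Lambda> i)) = coupling_mat (\<Lambda> i)" for i
      by (simp_all add: N_mat_def coupling_mat_def Let_def transpose_def vec_eq_iff forall_2)
    show "pos_semidef (gain_block H)" by (rule pos_semidef_gain_block[OF H22 \<open>invertible (blk22 H)\<close>])
    show "gain_block H $ Inr j $ Inr j = 0" "cross_block H $ Inr j $ Inr j = 0"
      by (simp_all add: gain_block_def cross_block_def block_mat_def)
  qed (use \<open>CARD('v) \<ge> 2\<close> \<open>\<gamma> > 0\<close> in auto)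
  interpret convex_concave "{2..CARD('v)}" ?S0 "gain_block H" "cross_block H" ?\<kappa>
      "\<lambda>i. N_mat 0 0 (\<Lambda> i)" "\<lambda>i. coupling_mat (\<Lambda> i)" "Inr j" for j
    by (rule cc)
  have T_eq: "T i x = N_mat (fst (snd x)) (snd (snd x)) (\<Lambda> i)" for i x
    unfolding T_def by (rule N_mat_affine[symmetric])
  have Sl_eq: "Sl ck i x = S_l Q \<gamma> (fst (snd x)) (snd (snd x)) ck (\<Lambda> i) H - mat (fst x)" for ck i x
    unfolding Sl_def S_def S_l_def S_mat_affine by (simp add: mat_eq_scaleR[of "fst x"])
  have Sq_eq: "Sq i x = S_q Q \<gamma> (fst (snd x)) (snd (snd x)) (\<Lambda> i) H - mat (fst x)" for i x
    unfolding Sq_def S_def S_q_def S_mat_affine by (simp add: mat_eq_scaleR[of "fst x"])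
  have feasible_eq: "subproblem_feasible Q \<gamma> H \<Lambda> CARD('v) ck = feasible ck" for ck
    by (auto simp: fun_eq_iff subproblem_feasible_def feasible_def Sl_eq T_eq)
  have iterates_eq: "ccp_iterates Q \<gamma> H \<Lambda> CARD('v) \<alpha> \<beta> c \<longleftrightarrow> iterates (\<lambda>k. (\<alpha> k, \<beta> k, c k))" for \<alpha> \<beta> c
    by (simp add: ccp_iterates_def iterates_def feasible_eq)
  have stationary_eq: "stationary Q \<gamma> H \<Lambda> CARD('v) x \<longleftrightarrow> kkt_point fst {2..CARD('v)} Sq T x" for x
  proof -
    have "(\<lambda>i (\<alpha>, \<beta>, c). S_q Q \<gamma> \<beta> c (\<Lambda> i) H - mat \<alpha>) = Sq" "(\<lambda>i (\<alpha>, \<beta>, c). N_mat \<beta> c (\<Lambda> i)) = T"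
      by (auto simp: fun_eq_iff Sq_eq T_eq)
    then show ?thesis by (simp add: stationary_def)
  qed
  \<comment> \<open>If \<open>blk12 H = 0\<close> or all \<open>\<Lambda> i\<close> vanish, the feasible set is unbounded, but the superfluous
    variables can be frozen.\<close>
  have attained: "\<exists>x. is_arg_max fst (feasible ck) x" for ck
  proof (rule subproblem_attained)
    fix \<alpha>0
    show "\<exists>b. \<forall>x. feasible ck x \<and> \<alpha>0 \<le> fst x \<longrightarrow>
      (\<exists>\<beta> c. feasible ck (fst x, \<beta>, c) \<and> \<bar>\<beta>\<bar> \<le> b \<and> \<bar>c\<bar> \<le> b)"
    proof (cases "blk12 H = 0")
      case True
      then have zero: "gain_block H = 0" "cross_block H = 0"
        by (simp_all add: gain_block_def cross_block_def block_mat_def vec_eq_iff transpose_def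
            matrix_matrix_mult_def split: sum.split)
      have Sl_const: "Sl ck i (\<alpha>, \<beta>, c) = Sl ck i (\<alpha>, \<beta>', c')" for i \<alpha> \<beta> c \<beta>' c'
        by (simp only: Sl_def S_def) (simp add: zero)
      \<comment> \<open>The pair \<open>\<beta>1\<close>, \<open>c1\<close> of one feasible point
        serves every objective value, because \<open>Sl\<close> now depends on the first component
        alone.\<close>
      obtain \<alpha>1 \<beta>1 c1 where *: "feasible ck (\<alpha>1, \<beta>1, c1)" using feasible_exists by (metis surj_pair)
      have "feasible ck (fst x, \<beta>1, c1)" if "feasible ck x" for x
        using that * Sl_const[of _ "fst x" "fst (snd x)" "snd (snd x)" \<beta>1 c1]
        by (auto simp: feasible_def T_def)
      then show ?thesis
        by (intro exI[of _ "max \<bar>\<beta>1\<bar> \<bar>c1\<bar>"] allI impI exI[of _ \<beta>1] exI[of _ c1]) auto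
    next
      case False
      then obtain r j where rj: "blk12 H $ r $ j \<noteq> 0" by (auto simp: vec_eq_iff)
      have entries: "?S0 $ Inl r $ Inr j = 0" "gain_block H $ Inl r $ Inr j = 0"
          "cross_block H $ Inl r $ Inl r = 0" "cross_block H $ Inl r $ Inr j \<noteq> 0"
        using rj by (simp_all add: gain_block_def cross_block_def block_mat_def)
      show ?thesis
      proof (cases "\<forall>i\<in>{2..CARD('v)}. \<Lambda> i = 0")
        case True
        have "2 \<in> {2..CARD('v)}" using \<open>CARD('v) \<ge> 2\<close> by simp
        define m where "m = \<bar>cross_block H $ Inl r $ Inr j\<bar>"
        \<comment> \<open>With \<open>\<Lambda> 2 = 0\<close> the term in
          \<open>\<bar>c\<bar>\<close> drops out of the off-diagonal bound, so weight
          \<open>s = 1\<close> already bounds \<open>\<beta>\<close>.\<close>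
        define b where "b = ((?S0 $ Inl r $ Inl r - \<alpha>0) + (?S0 $ Inr j $ Inr j - \<alpha>0)) / (2 * m)"
        have "m > 0" using entries(4) by (simp add: m_def)
        have bd: "\<bar>fst (snd x)\<bar> \<le> b" if "feasible ck x" "\<alpha>0 \<le> fst x" for x
          using offdiagonal_bound[OF that(1) \<open>2 \<in> _\<close> that(2) zero_less_one entries] True \<open>2 \<in> _\<close> \<open>m > 0\<close>
          by (simp add: b_def m_def[symmetric] field_simps)
        have "feasible ck (fst x, fst (snd x), 0)" if "feasible ck x" for x
        proof -
          have "coupling_mat 0 = 0" by (simp add: coupling_mat_def vec_eq_iff forall_2)
          then have "Sl ck i (fst x, fst (snd x), 0) = Sl ck i x \<and> T i (fst x, fst (snd x), 0) = T i x"
            if "i \<in> {2..CARD('v)}" for i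
            using True that by (simp add: Sl_def S_def T_def)
          then show ?thesis using that by (simp add: feasible_def)
        qed
        then show ?thesis
          using bd by (intro exI[of _ b]) force
      next
        case False
        \<comment> \<open>A nonzero eigenvalue provides the linear growth of \<open>\<beta>\<close>
          in \<open>\<bar>c\<bar>\<close>, at rate \<open>cmod (\<Lambda> i)\<close>.\<close>
        then obtain i where "i \<in> {2..CARD('v)}" "0 < cmod (\<Lambda> i)" by auto
        then obtain b where "\<forall>x. feasible ck x \<and> \<alpha>0 \<le> fst x \<longrightarrow> \<bar>fst (snd x)\<bar> \<le> b \<and> \<bar>snd (snd x)\<bar> \<le> b"
          using feasible_bounded[of i "cmod (\<Lambda> i)", OF _ _ _ entries] N_mat_pos_semidef_imp_le
          unfolding T_eq by blast
        then show ?thesis by (metis prod.collapse)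
      qed
    qed
  qed
  show ?thesis
  proof (intro allI conjI impI; (elim conjE)?)
    fix c0 :: real
    obtain X where X: "snd (snd (X 0)) = c0" "iterates X" using iterates_exist[OF attained] by blast
    show "\<exists>\<alpha> \<beta> c. c 0 = c0 \<and> ccp_iterates Q \<gamma> H \<Lambda> CARD('v) \<alpha> \<beta> c"
      using X by (intro exI[of _ "\<lambda>k. fst (X k)"] exI[of _ "\<lambda>k. fst (snd (X k))"] exI[of _ "\<lambda>k. snd (snd (X k))"])
        (simp add: iterates_eq)
  next
    fix c0 \<alpha> \<beta> c
    assume "ccp_iterates Q \<gamma> H \<Lambda> CARD('v) \<alpha> \<beta> c"
    then have it: "iterates (\<lambda>k. (\<alpha> k, \<beta> k, c k))" by (simp add: iterates_eq)
    show "\<alpha> k \<le> \<alpha> (Suc k)" if "1 \<le> k" for k using objective_mono_Suc[OF it that] by simp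
    show "convergent \<alpha>" using objective_convergent[OF it] by simp
    show lp: "stationary Q \<gamma> H \<Lambda> CARD('v) x" if "seq_limit_point (\<lambda>k. (\<alpha> k, \<beta> k, c k)) x" for x
      using limit_point_kkt[OF it that] by (simp add: stationary_eq)
    assume bdd: "bounded (range (\<lambda>k. (\<alpha> k, \<beta> k, c k)))"
    show "\<exists>x. seq_limit_point (\<lambda>k. (\<alpha> k, \<beta> k, c k)) x"
      \<comment> \<open>The target set \<open>UNIV\<close> makes the condition on limit points
        trivial.\<close>
      using bounded_seq_infdist_tendsto_0(1)[OF bdd, of UNIV] by simp
    show "(\<lambda>k. infdist (\<alpha> k, \<beta> k, c k) {x. stationary Q \<gamma> H \<Lambda> CARD('v) x}) \<longlonglongrightarrow> 0"
      using lp by (intro bounded_seq_infdist_tendsto_0(2)[OF bdd]) simp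
  qed
qed

end
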